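(* Let $(M^n,g,V,\lambda,\beta)$, $n\ge4$, be a compact almost $\omega$-Bach soliton with $S(V,V)\ge0$, whose potential vector field $V$ is an affine conformal vector field, and such that $\omega$ is a harmonic $1$-form with associated vector field $V$ (i.e. $\omega(X)=g(X,V)$). If the $\omega$-Bach tensor is divergence free, then the almost $\omega$-Bach soliton is an $\omega$-Bach soliton (i.e. $\lambda$ is constant) and $V$ is an affine vector field.
   Context: $S$ denotes the Ricci tensor and $W$ the Weyl tensor, $W=R-\frac{2}{n-2}S\odot g+\frac{r}{(n-1)(n-2)}g\odot g$ ($\odot$ is the Kulkarni-Nomizu product, normalized so that $W$ is the trace-free part of the curvature tensor $R$; $r$ is the scalar curvature). The Bach tensor is the symmetric trace-free $(0,2)$ tensor $$B(X,Y)=\frac{1}{n-3}\sum_{i,j}(\nabla_{e_i}\nabla_{e_j}W)(X,e_i,e_j,Y)+\frac{1}{n-2}\sum_{i,j}S(e_i,e_j)W(X,e_i,e_j,Y),$$ with $\{e_i\}$ a local orthonormal frame. Given a vector field $P$ with associated $1$-form $\omega(X)=g(X,P)$ and $\beta\in\mathbb{R}$, the $\omega$-Bach tensor is $B_\omega=B-\beta\,\omega\otimes\omega$. $(M^n,g,V,\lambda,\beta)$ is an almost $\omega$-Bach soliton with potential vector field $V$ if $\frac12\mathfrak{L}_Vg+B_\omega=\lambda g$ with $\lambda\in C^\infty(M)$; it is an $\omega$-Bach soliton if $\lambda$ is constant. A vector field $V$ is affine conformal if there is $f\in C^\infty(M)$ with $(\mathfrak{L}_V\nabla)(X,Y)=(Xf)Y+(Yf)X-g(X,Y)\nabla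 f$ for all vector fields $X,Y$; it is affine if $\mathfrak{L}_V\nabla=0$ ($\nabla$ the Levi-Civita connection). A $1$-form $\omega$ is harmonic if $d\omega=0$ and $\delta\omega=0$. The divergence of a symmetric $(0,2)$ tensor $T$ is $(\operatorname{div}T)(Z)=\sum_i(\nabla_{e_i}T)(e_i,Z)$. *)

theory Defs
  imports "HOL-Analysis.Analysis"
begin

section \<open>Smooth maps between Euclidean spaces\<close>

primrec Ck_on ::
  "nat \<Rightarrow> 'a::euclidean_space set \<Rightarrow> ('a \<Rightarrow> 'b::real_normed_vector) \<Rightarrow> bool" where
  "Ck_on 0 S f \<longleftrightarrow> continuous_on S f"
| "Ck_on (Suc k) S f \<longleftrightarrow>
     (\<forall>x\<in>S. f differentiable (at x)) \<and>
     (\<forall>v. Ck_on k S (\<lambda>x. frechet_derivative f (at x) v))"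

text \<open>Meant for open sets \<open>S\<close> only, since the derivatives are two-sided.\<close>

definition smooth_on :: "'a::euclidean_space set \<Rightarrow> ('a \<Rightarrow> 'b::real_normed_vector) \<Rightarrow> bool" where
  "smooth_on S f \<longleftrightarrow> (\<forall>k. Ck_on k S f)"


section \<open>Smooth manifolds\<close>

text \<open>
  The manifold is the whole type \<open>'a\<close>, its dimension is \<open>CARD('n)\<close>, and a chart is a pair
  \<open>(W, \<phi>)\<close> of its domain and its coordinate map.  The atlas need not be maximal.
\<close>

type_synonym ('a, 'n) atlas = "('a set \<times> ('a \<Rightarrow> real ^ 'n)) set"

definition smooth_atlas ::
  "('a::{t2_space, second_countable_topology}, 'n::finite) atlas \<Rightarrow> bool" where
  "smooth_atlas A \<longleftrightarrow>
     (\<Union>(W, \<phi>)\<in>A. W) = UNIV \<and>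
     (\<forall>(W, \<phi>)\<in>A. open W \<and> open (\<phi> ` W) \<and> homeomorphism W (\<phi> ` W) \<phi> (inv_into W \<phi>)) \<and>
     (\<forall>(W, \<phi>)\<in>A. \<forall>(W', \<phi>')\<in>A. smooth_on (\<phi> ` (W \<inter> W')) (\<phi>' \<circ> inv_into W \<phi>))"

definition smooth_fun ::
  "('a::topological_space, 'n::finite) atlas \<Rightarrow> 'a set \<Rightarrow> ('a \<Rightarrow> real) \<Rightarrow> bool" where
  "smooth_fun A U f \<longleftrightarrow> (\<forall>(W, \<phi>)\<in>A. smooth_on (\<phi> ` (U \<inter> W)) (f \<circ> inv_into W \<phi>))"

definition smooth_at ::
  "('a::topological_space, 'n::finite) atlas \<Rightarrow> 'a \<Rightarrow> ('a \<Rightarrow> real) \<Rightarrow> bool" where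
  "smooth_at A p f \<longleftrightarrow> (\<exists>U. open U \<and> p \<in> U \<and> smooth_fun A U f)"


section \<open>Tangent vectors and vector fields\<close>

text \<open>
  A tangent vector at \<open>p\<close> is a directional derivative \<open>h \<mapsto> d(h \<circ> \<phi>\<^sup>-\<^sup>1)(\<phi> p) \<xi>\<close>, acting on the
  functions that are smooth near \<open>p\<close>.  On all other functions it is set to 0, so that equality in
  HOL is equality of tangent vectors; the vector space operations are the pointwise ones.
\<close>

type_synonym 'a tvec = "('a \<Rightarrow> real) \<Rightarrow> real"
type_synonym 'a field = "'a \<Rightarrow> 'a tvec"

definition tangent_space ::
  "('a::topological_space, 'n::finite) atlas \<Rightarrow> 'a \<Rightarrow> 'a tvec set" where
  "tangent_space A p =
     {v. \<exists>(W, \<phi>)\<in>A. p \<in> W \<and> (\<exists>\<xi>. v = (\<lambda>h.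
           if smooth_at A p h then frechet_derivative (h \<circ> inv_into W \<phi>) (at (\<phi> p)) \<xi> else 0))}"

text \<open>
  Vector fields are defined on open sets \<open>U\<close>; their values off \<open>U\<close> are irrelevant.  The function
  \<open>X h\<close> is written \<open>\<lambda>q. X q h\<close>.
\<close>

definition vector_field_on ::
  "('a::topological_space, 'n::finite) atlas \<Rightarrow> 'a set \<Rightarrow> 'a field \<Rightarrow> bool" where
  "vector_field_on A U X \<longleftrightarrow>
     open U \<and> (\<forall>p\<in>U. X p \<in> tangent_space A p) \<and>
     (\<forall>W h. open W \<and> W \<subseteq> U \<and> smooth_fun A W h \<longrightarrow> smooth_fun A W (\<lambda>q. X q h))"

definition lie_bracket ::
  "('a::topological_space, 'n::finite) atlas \<Rightarrow> 'a field \<Rightarrow> 'a field \<Rightarrow> 'a field" where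
  "lie_bracket A X Y = (\<lambda>p h.
     if smooth_at A p h then X p (\<lambda>q. Y q h) - Y p (\<lambda>q. X q h) else 0)"


section \<open>Riemannian metrics and the Levi-Civita connection\<close>

type_synonym 'a form1 = "'a \<Rightarrow> 'a tvec \<Rightarrow> real"
type_synonym 'a metric = "'a \<Rightarrow> 'a tvec \<Rightarrow> 'a tvec \<Rightarrow> real"
type_synonym 'a connection = "'a field \<Rightarrow> 'a field \<Rightarrow> 'a field"
type_synonym 'a tensor2 = "'a field \<Rightarrow> 'a field \<Rightarrow> 'a \<Rightarrow> real"
type_synonym 'a tensor4 = "'a field \<Rightarrow> 'a field \<Rightarrow> 'a field \<Rightarrow> 'a field \<Rightarrow> 'a \<Rightarrow> real"

definition metric_app :: "'a metric \<Rightarrow> 'a tensor2" where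
  "metric_app g X Y = (\<lambda>p. g p (X p) (Y p))"

definition riemannian_metric ::
  "('a::topological_space, 'n::finite) atlas \<Rightarrow> 'a metric \<Rightarrow> bool" where
  "riemannian_metric A g \<longleftrightarrow>
     (\<forall>p. \<forall>x\<in>tangent_space A p. \<forall>y\<in>tangent_space A p. \<forall>z\<in>tangent_space A p. \<forall>a.
        g p x y = g p y x \<and>
        g p (\<lambda>h. x h + y h) z = g p x z + g p y z \<and>
        g p (\<lambda>h. a * x h) y = a * g p x y) \<and>
     (\<forall>p. \<forall>x\<in>tangent_space A p. x \<noteq> (\<lambda>h. 0) \<longrightarrow> g p x x > 0) \<and>
     (\<forall>U X Y. vector_field_on A U X \<and> vector_field_on A U Y
        \<longrightarrow> smooth_fun A U (metric_app g X Y))"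

definition riemannian_manifold ::
  "('a::{t2_space, second_countable_topology}, 'n::finite) atlas \<Rightarrow> 'a metric \<Rightarrow> bool" where
  "riemannian_manifold A g \<longleftrightarrow>
     smooth_atlas A \<and> connected (UNIV :: 'a set) \<and> riemannian_metric A g"

text \<open>\<open>D X Y\<close> stands for \<open>\<nabla>\<^sub>X Y\<close>; one operator serves the vector fields on every open set.\<close>

definition levi_civita ::
  "('a::topological_space, 'n::finite) atlas \<Rightarrow> 'a metric \<Rightarrow> 'a connection \<Rightarrow> bool" where
  "levi_civita A g D \<longleftrightarrow>
     (\<forall>U X Y Z f. vector_field_on A U X \<and> vector_field_on A U Y \<and> vector_field_on A U Z \<and>
          smooth_fun A U f \<longrightarrow>
        vector_field_on A U (D X Y) \<and>
        (\<forall>p\<in>U.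
           D (\<lambda>q h. X q h + Z q h) Y p = (\<lambda>h. D X Y p h + D Z Y p h) \<and>
           D (\<lambda>q h. f q * X q h) Y p = (\<lambda>h. f p * D X Y p h) \<and>
           D X (\<lambda>q h. Y q h + Z q h) p = (\<lambda>h. D X Y p h + D X Z p h) \<and>
           D X (\<lambda>q h. f q * Y q h) p = (\<lambda>h. X p f * Y p h + f p * D X Y p h) \<and>
           (\<lambda>h. D X Y p h - D Y X p h) = lie_bracket A X Y p \<and>
           X p (metric_app g Y Z) = metric_app g (D X Y) Z p + metric_app g Y (D X Z) p))"

definition gradient ::
  "('a::topological_space, 'n::finite) atlas \<Rightarrow> 'a metric \<Rightarrow> ('a \<Rightarrow> real) \<Rightarrow> 'a field" where
  "gradient A g f p =
     (THE v. v \<in> tangent_space A p \<and> (\<forall>w\<in>tangent_space A p. g p v w = w f))"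


section \<open>Local orthonormal frames, covariant derivatives, divergence\<close>

definition orthonormal_frame_on ::
  "('a::topological_space, 'n::finite) atlas \<Rightarrow> 'a metric \<Rightarrow> 'a set \<Rightarrow> ('n \<Rightarrow> 'a field) \<Rightarrow> bool" where
  "orthonormal_frame_on A g U E \<longleftrightarrow>
     (\<forall>i. vector_field_on A U (E i)) \<and>
     (\<forall>q\<in>U. \<forall>i j. metric_app g (E i) (E j) q = (if i = j then 1 else 0))"

text \<open>
  Some orthonormal frame on a neighbourhood of \<open>p\<close>.  It is only used for traces at \<open>p\<close> of
  expressions that are tensorial in the traced slots, which do not depend on the choice.
\<close>

definition local_frame ::
  "('a::topological_space, 'n::finite) atlas \<Rightarrow> 'a metric \<Rightarrow> 'a \<Rightarrow> 'n \<Rightarrow> 'a field" where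
  "local_frame A g p = (SOME E. \<exists>U. open U \<and> p \<in> U \<and> orthonormal_frame_on A g U E)"

definition cov_form1 :: "'a connection \<Rightarrow> 'a field \<Rightarrow> 'a form1 \<Rightarrow> 'a field \<Rightarrow> 'a \<Rightarrow> real" where
  "cov_form1 D X \<omega> Y = (\<lambda>p. X p (\<lambda>q. \<omega> q (Y q)) - \<omega> p (D X Y p))"

definition cov_tensor2 :: "'a connection \<Rightarrow> 'a field \<Rightarrow> 'a tensor2 \<Rightarrow> 'a tensor2" where
  "cov_tensor2 D X T Y Z = (\<lambda>p. X p (T Y Z) - T (D X Y) Z p - T Y (D X Z) p)"

definition cov_tensor4 :: "'a connection \<Rightarrow> 'a field \<Rightarrow> 'a tensor4 \<Rightarrow> 'a tensor4" where
  "cov_tensor4 D X T Y1 Y2 Y3 Y4 = (\<lambda>p. X p (T Y1 Y2 Y3 Y4)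
     - T (D X Y1) Y2 Y3 Y4 p - T Y1 (D X Y2) Y3 Y4 p
     - T Y1 Y2 (D X Y3) Y4 p - T Y1 Y2 Y3 (D X Y4) p)"

text \<open>The second covariant derivative \<open>\<nabla>\<^sup>2\<^sub>X\<^sub>,\<^sub>Y T\<close>, tensorial in \<open>X\<close> and \<open>Y\<close>.\<close>

definition cov2_tensor4 ::
  "'a connection \<Rightarrow> 'a field \<Rightarrow> 'a field \<Rightarrow> 'a tensor4 \<Rightarrow> 'a tensor4" where
  "cov2_tensor4 D X Y T Z1 Z2 Z3 Z4 = (\<lambda>p.
     cov_tensor4 D X (cov_tensor4 D Y T) Z1 Z2 Z3 Z4 p
     - cov_tensor4 D (D X Y) T Z1 Z2 Z3 Z4 p)"

definition divergence ::
  "('a::topological_space, 'n::finite) atlas \<Rightarrow> 'a metric \<Rightarrow> 'a connection \<Rightarrow> 'a tensor2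
     \<Rightarrow> 'a field \<Rightarrow> 'a \<Rightarrow> real" where
  "divergence A g D T Z p =
     (let E = local_frame A g p in \<Sum>i\<in>UNIV. cov_tensor2 D (E i) T (E i) Z p)"

definition divergence_free ::
  "('a::topological_space, 'n::finite) atlas \<Rightarrow> 'a metric \<Rightarrow> 'a connection \<Rightarrow> 'a tensor2 \<Rightarrow> bool" where
  "divergence_free A g D T \<longleftrightarrow>
     (\<forall>U Z. vector_field_on A U Z \<longrightarrow> (\<forall>p\<in>U. divergence A g D T Z p = 0))"


section \<open>Curvature, Weyl and Bach tensors\<close>

definition curvature ::
  "('a::topological_space, 'n::finite) atlas \<Rightarrow> 'a connection
     \<Rightarrow> 'a field \<Rightarrow> 'a field \<Rightarrow> 'a field \<Rightarrow> 'a field" where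
  "curvature A D X Y Z =
     (\<lambda>p h. D X (D Y Z) p h - D Y (D X Z) p h - D (lie_bracket A X Y) Z p h)"

definition riemann_tensor ::
  "('a::topological_space, 'n::finite) atlas \<Rightarrow> 'a metric \<Rightarrow> 'a connection \<Rightarrow> 'a tensor4" where
  "riemann_tensor A g D X Y Z U = metric_app g (curvature A D X Y Z) U"

text \<open>With this sign of \<open>R\<close> the Ricci tensor of the round sphere is positive.\<close>

definition ricci_tensor ::
  "('a::topological_space, 'n::finite) atlas \<Rightarrow> 'a metric \<Rightarrow> 'a connection \<Rightarrow> 'a tensor2" where
  "ricci_tensor A g D Y Z = (\<lambda>p.
     let E = local_frame A g p in \<Sum>i\<in>UNIV. riemann_tensor A g D (E i) Y Z (E i) p)"

definition scalar_curvature ::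
  "('a::topological_space, 'n::finite) atlas \<Rightarrow> 'a metric \<Rightarrow> 'a connection \<Rightarrow> 'a \<Rightarrow> real" where
  "scalar_curvature A g D p =
     (let E = local_frame A g p in \<Sum>i\<in>UNIV. ricci_tensor A g D (E i) (E i) p)"

text \<open>
  The factor 1/2 makes the Weyl tensor below trace-free: \<open>g \<odot> g\<close> is the curvature tensor of
  constant sectional curvature 1.
\<close>

definition kulkarni_nomizu :: "'a tensor2 \<Rightarrow> 'a tensor2 \<Rightarrow> 'a tensor4" where
  "kulkarni_nomizu S T X Y Z U = (\<lambda>p.
     (S X U p * T Y Z p + S Y Z p * T X U p - S X Z p * T Y U p - S Y U p * T X Z p) / 2)"

definition weyl_tensor ::
  "('a::topological_space, 'n::finite) atlas \<Rightarrow> 'a metric \<Rightarrow> 'a connection \<Rightarrow> 'a tensor4" where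
  "weyl_tensor A g D X Y Z U = (\<lambda>p.
     let n = real CARD('n) in
     riemann_tensor A g D X Y Z U p
     - 2 / (n - 2) * kulkarni_nomizu (ricci_tensor A g D) (metric_app g) X Y Z U p
     + scalar_curvature A g D p / ((n - 1) * (n - 2))
         * kulkarni_nomizu (metric_app g) (metric_app g) X Y Z U p)"

definition bach_tensor ::
  "('a::topological_space, 'n::finite) atlas \<Rightarrow> 'a metric \<Rightarrow> 'a connection \<Rightarrow> 'a tensor2" where
  "bach_tensor A g D X Y = (\<lambda>p.
     let n = real CARD('n); E = local_frame A g p; W = weyl_tensor A g D in
     1 / (n - 3) * (\<Sum>i\<in>UNIV. \<Sum>j\<in>UNIV. cov2_tensor4 D (E i) (E j) W X (E i) (E j) Y p)
     + 1 / (n - 2) * (\<Sum>i\<in>UNIV. \<Sum>j\<in>UNIV.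
         ricci_tensor A g D (E i) (E j) p * W X (E i) (E j) Y p))"


section \<open>Almost \<open>\<omega>\<close>-Bach solitons\<close>

definition associated_form ::
  "('a::topological_space, 'n::finite) atlas \<Rightarrow> 'a metric \<Rightarrow> 'a field \<Rightarrow> 'a form1 \<Rightarrow> bool" where
  "associated_form A g P \<omega> \<longleftrightarrow> (\<forall>p. \<forall>x\<in>tangent_space A p. \<omega> p x = g p x (P p))"

definition omega_bach_tensor ::
  "('a::topological_space, 'n::finite) atlas \<Rightarrow> 'a metric \<Rightarrow> 'a connection
     \<Rightarrow> 'a form1 \<Rightarrow> real \<Rightarrow> 'a tensor2" where
  "omega_bach_tensor A g D \<omega> \<beta> X Y =
     (\<lambda>p. bach_tensor A g D X Y p - \<beta> * (\<omega> p (X p) * \<omega> p (Y p)))"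

definition lie_metric ::
  "('a::topological_space, 'n::finite) atlas \<Rightarrow> 'a metric \<Rightarrow> 'a field \<Rightarrow> 'a tensor2" where
  "lie_metric A g V X Y = (\<lambda>p. V p (metric_app g X Y)
     - metric_app g (lie_bracket A V X) Y p - metric_app g X (lie_bracket A V Y) p)"

definition lie_connection ::
  "('a::topological_space, 'n::finite) atlas \<Rightarrow> 'a connection \<Rightarrow> 'a field
     \<Rightarrow> 'a field \<Rightarrow> 'a field \<Rightarrow> 'a field" where
  "lie_connection A D V X Y = (\<lambda>p h. lie_bracket A V (D X Y) p h
     - D (lie_bracket A V X) Y p h - D X (lie_bracket A V Y) p h)"

definition almost_omega_bach_soliton ::
  "('a::topological_space, 'n::finite) atlas \<Rightarrow> 'a metric \<Rightarrow> 'a connection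
     \<Rightarrow> 'a form1 \<Rightarrow> 'a field \<Rightarrow> ('a \<Rightarrow> real) \<Rightarrow> real \<Rightarrow> bool" where
  "almost_omega_bach_soliton A g D \<omega> V lam \<beta> \<longleftrightarrow>
     (\<exists>P. vector_field_on A UNIV P \<and> associated_form A g P \<omega>) \<and>
     vector_field_on A UNIV V \<and>
     smooth_fun A UNIV lam \<and>
     (\<forall>U X Y. vector_field_on A U X \<and> vector_field_on A U Y \<longrightarrow> (\<forall>p\<in>U.
        1 / 2 * lie_metric A g V X Y p + omega_bach_tensor A g D \<omega> \<beta> X Y p
          = lam p * metric_app g X Y p))"

definition omega_bach_soliton ::
  "('a::topological_space, 'n::finite) atlas \<Rightarrow> 'a metric \<Rightarrow> 'a connection
     \<Rightarrow> 'a form1 \<Rightarrow> 'a field \<Rightarrow> ('a \<Rightarrow> real) \<Rightarrow> real \<Rightarrow> bool" where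
  "omega_bach_soliton A g D \<omega> V lam \<beta> \<longleftrightarrow>
     almost_omega_bach_soliton A g D \<omega> V lam \<beta> \<and> (\<exists>c. \<forall>p. lam p = c)"

definition affine_conformal_field ::
  "('a::topological_space, 'n::finite) atlas \<Rightarrow> 'a metric \<Rightarrow> 'a connection \<Rightarrow> 'a field \<Rightarrow> bool" where
  "affine_conformal_field A g D V \<longleftrightarrow>
     vector_field_on A UNIV V \<and>
     (\<exists>f. smooth_fun A UNIV f \<and>
       (\<forall>U X Y. vector_field_on A U X \<and> vector_field_on A U Y \<longrightarrow> (\<forall>p\<in>U.
          lie_connection A D V X Y p = (\<lambda>h.
            X p f * Y p h + Y p f * X p h - metric_app g X Y p * gradient A g f p h))))"

definition affine_field ::
  "('a::topological_space, 'n::finite) atlas \<Rightarrow> 'a connection \<Rightarrow> 'a field \<Rightarrow> bool" where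
  "affine_field A D V \<longleftrightarrow>
     vector_field_on A UNIV V \<and>
     (\<forall>U X Y. vector_field_on A U X \<and> vector_field_on A U Y \<longrightarrow>
        (\<forall>p\<in>U. lie_connection A D V X Y p = (\<lambda>h. 0)))"

definition exterior_derivative1 ::
  "('a::topological_space, 'n::finite) atlas \<Rightarrow> 'a form1 \<Rightarrow> 'a tensor2" where
  "exterior_derivative1 A \<omega> X Y = (\<lambda>p.
     X p (\<lambda>q. \<omega> q (Y q)) - Y p (\<lambda>q. \<omega> q (X q)) - \<omega> p (lie_bracket A X Y p))"

definition codifferential1 ::
  "('a::topological_space, 'n::finite) atlas \<Rightarrow> 'a metric \<Rightarrow> 'a connection
     \<Rightarrow> 'a form1 \<Rightarrow> 'a \<Rightarrow> real" where
  "codifferential1 A g D \<omega> p =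
     - (let E = local_frame A g p in \<Sum>i\<in>UNIV. cov_form1 D (E i) \<omega> (E i) p)"

definition harmonic_form1 ::
  "('a::topological_space, 'n::finite) atlas \<Rightarrow> 'a metric \<Rightarrow> 'a connection \<Rightarrow> 'a form1 \<Rightarrow> bool" where
  "harmonic_form1 A g D \<omega> \<longleftrightarrow>
     (\<forall>U X Y. vector_field_on A U X \<and> vector_field_on A U Y \<longrightarrow>
        (\<forall>p\<in>U. exterior_derivative1 A \<omega> X Y p = 0)) \<and>
     (\<forall>p. codifferential1 A g D \<omega> p = 0)"

end

theory Submission
  imports Defs
begin

text \<open>
  Put \<open>h = \<nabla>\<omega>\<close>.  Since \<open>\<omega>\<close> is closed, \<open>h\<close> is symmetric and \<open>\<L>\<^sub>V g = 2 h\<close>; since \<open>\<omega>\<close> is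
  coclosed, \<open>h\<close> is trace-free.  For every field \<open>V\<close>,
  \<open>(\<nabla>\<^sub>X \<L>\<^sub>V g)(Y, Z) = g((\<L>\<^sub>V \<nabla>)(X, Y), Z) + g(Y, (\<L>\<^sub>V \<nabla>)(X, Z))\<close>, which is
  \<open>2 (X f) g(Y, Z)\<close> if \<open>V\<close> is affine conformal with function \<open>f\<close>.  The trace gives \<open>n (X f) = 0\<close>,
  so \<open>V\<close> is affine and \<open>\<nabla>h = 0\<close>.  The divergence of \<open>B\<^sub>\<omega> = \<lambda> g - h\<close> is then \<open>d\<lambda>\<close>, and \<open>\<lambda>\<close> is
  constant because \<open>M\<close> is connected.
\<close>


section \<open>Calculus of smooth maps\<close>

text \<open>The trace of \<open>\<nabla>\<^sub>X h\<close> vanishes because a trace over an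
  orthonormal frame commutes with \<open>\<nabla>\<^sub>X\<close>: the derivatives of the frame
  enter through coefficients that are skew, and these are paired with the symmetric
  \<open>h\<close>.

  The formal proof is shaped by the fact that connection, tensors and divergence act on fields, not
  on vectors. A claim about a tangent vector is proved by extending the vector to a field near its
  point, and all fields of one argument must share an open set. \<open>D\<close> is known only
  through its axioms, so its locality in the first slot has to be derived; it is what allows frame
  expansions, which hold on an open set only, to be substituted into \<open>D\<close>.

  Codifferential and divergence are traces over a frame that is chosen separately at each point. To
  differentiate the trace of \<open>h\<close> along \<open>X\<close>, one frame must serve all
  nearby points; hence the independence of the trace from the frame, and the construction of frames
  by a smooth Gram-Schmidt process.\<close>

lemma Ck_on_subset: "Ck_on k S f \<Longrightarrow> T \<subseteq> S \<Longrightarrow> Ck_on k T f"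
  by (induction k arbitrary: f) (auto intro: continuous_on_subset)

lemma Ck_on_SucD: "Ck_on (Suc k) S f \<Longrightarrow> Ck_on k S f"
proof (induction k arbitrary: f)
  case 0
  then show ?case
    by (auto intro!: continuous_at_imp_continuous_on differentiable_imp_continuous_within)
next
  case (Suc k)
  then show ?case
    by (metis Ck_on.simps(2))
qed

text \<open>\<open>frechet_derivative\<close> is a choice among the derivatives, and functions that
  agree near \<open>x\<close> have the same derivatives. This covers points where no derivative
  exists.\<close>

lemma frechet_derivative_cong_open:
  fixes f f' :: "'a::real_normed_vector \<Rightarrow> 'b::real_normed_vector"
  assumes "open S" "x \<in> S" "\<And>y. y \<in> S \<Longrightarrow> f y = f' y"
  shows "frechet_derivative f (at x) = frechet_derivative f' (at x)"
proof -
  have "(f has_derivative F) (at x) \<longleftrightarrow> (f' has_derivative F) (at x)" for F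
    using has_derivative_transform_within_open[of f F x UNIV S f']
      has_derivative_transform_within_open[of f' F x UNIV S f] assms by auto
  then show ?thesis
    by (simp add: frechet_derivative_def)
qed

lemma differentiable_cong_open:
  assumes "open S" "x \<in> S" "\<And>y. y \<in> S \<Longrightarrow> f y = f' y" "f differentiable (at x)"
  shows "f' differentiable (at x)"
  using assms has_derivative_transform_within_open[of f _ x UNIV S f']
  unfolding differentiable_def by metis

lemma Ck_on_cong:
  assumes "open S" "\<And>x. x \<in> S \<Longrightarrow> f x = f' x" "Ck_on k S f"
  shows "Ck_on k S f'"
  using assms(2,3)
proof (induction k arbitrary: f f')
  case 0
  then show ?case
    by (metis Ck_on.simps(1) continuous_on_cong)
next
  case (Suc k)
  have "Ck_on k S (\<lambda>x. frechet_derivative f' (at x) v)" for v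
    using Suc.IH[of "\<lambda>x. frechet_derivative f (at x) v" "\<lambda>x. frechet_derivative f' (at x) v"]
      Suc.prems frechet_derivative_cong_open[OF assms(1), of _ f f'] by auto
  moreover have "f' differentiable (at x)" if "x \<in> S" for x
    using differentiable_cong_open[OF assms(1) that, of f f'] Suc.prems that by auto
  ultimately show ?case by simp
qed

lemma Ck_on_const: "Ck_on k S (\<lambda>x. c)"
  by (induction k arbitrary: c) auto

lemma Ck_on_add:
  assumes "open S" "Ck_on k S f" "Ck_on k S f'"
  shows "Ck_on k S (\<lambda>x. f x + f' x)"
  using assms(2,3)
proof (induction k arbitrary: f f')
  case 0
  then show ?case by (auto intro: continuous_intros)
next
  case (Suc k)
  have d: "f differentiable (at x)" "f' differentiable (at x)" if "x \<in> S" for x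
    using Suc.prems that by auto
  have "frechet_derivative (\<lambda>x. f x + f' x) (at x) v
      = frechet_derivative f (at x) v + frechet_derivative f' (at x) v" if "x \<in> S" for x v
    using frechet_derivative_at[OF has_derivative_add[OF
          frechet_derivative_works[THEN iffD1, OF d(1)[OF that]]
          frechet_derivative_works[THEN iffD1, OF d(2)[OF that]]], symmetric] by simp
  then have e: "frechet_derivative f (at x) v + frechet_derivative f' (at x) v
      = frechet_derivative (\<lambda>x. f x + f' x) (at x) v" if "x \<in> S" for x v
    using that by simp
  have "Ck_on k S (\<lambda>x. frechet_derivative f (at x) v + frechet_derivative f' (at x) v)" for v
    using Suc.IH Suc.prems by simp
  then have "Ck_on k S (\<lambda>x. frechet_derivative (\<lambda>x. f x + f' x) (at x) v)" for v
    by (rule Ck_on_cong[OF assms(1), rotated]) (rule e)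
  then show ?case
    using d by auto
qed

lemma Ck_on_sum:
  assumes "open S" "finite I" "\<And>i. i \<in> I \<Longrightarrow> Ck_on k S (f i)"
  shows "Ck_on k S (\<lambda>x. \<Sum>i\<in>I. f i x)"
  using assms(2,3) by (induction I rule: finite_induct) (auto intro: Ck_on_const Ck_on_add[OF assms(1)])

text \<open>By the product rule every directional derivative is a sum of two products, each with one
  undifferentiated factor. \<open>Ck_on_SucD\<close> lowers the order of that factor, so the
  induction quantifies over both factors.\<close>

lemma Ck_on_scaleR:
  fixes f :: "'a::euclidean_space \<Rightarrow> real"
  assumes "open S" "Ck_on k S f" "Ck_on k S f'"
  shows "Ck_on k S (\<lambda>x. f x *\<^sub>R f' x)"
  using assms(2,3)
proof (induction k arbitrary: f f')
  case 0
  then show ?case by (auto intro: continuous_intros)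
next
  case (Suc k)
  have d: "f differentiable (at x)" "f' differentiable (at x)" if "x \<in> S" for x
    using Suc.prems that by auto
  have e: "frechet_derivative (\<lambda>x. f x *\<^sub>R f' x) (at x) v
      = f x *\<^sub>R frechet_derivative f' (at x) v + frechet_derivative f (at x) v *\<^sub>R f' x"
    if "x \<in> S" for x v
    using frechet_derivative_at[OF has_derivative_scaleR[OF
          frechet_derivative_works[THEN iffD1, OF d(1)[OF that]]
          frechet_derivative_works[THEN iffD1, OF d(2)[OF that]]], symmetric] by simp
  have "Ck_on k S (\<lambda>x. frechet_derivative (\<lambda>x. f x *\<^sub>R f' x) (at x) v)" for v
    by (rule Ck_on_cong[OF assms(1), of "\<lambda>x. f x *\<^sub>R frechet_derivative f' (at x) v
          + frechet_derivative f (at x) v *\<^sub>R f' x"])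
      (use e Suc.prems in \<open>auto intro!: Ck_on_add[OF assms(1)] Suc.IH intro: Ck_on_SucD\<close>)
  then show ?case
    using d by (auto intro!: differentiable_scaleR)
qed

lemma Ck_on_bounded_linear_compose:
  assumes "open S" "bounded_linear L" "Ck_on k S f"
  shows "Ck_on k S (\<lambda>x. L (f x))"
  using assms(3)
proof (induction k arbitrary: f)
  case 0
  then show ?case
    using bounded_linear.continuous_on[OF assms(2)] by auto
next
  case (Suc k)
  have h: "((\<lambda>x. L (f x)) has_derivative (\<lambda>v. L (frechet_derivative f (at x) v))) (at x)"
    if "x \<in> S" for x
  proof (rule bounded_linear.has_derivative[OF assms(2)])
    show "(f has_derivative frechet_derivative f (at x)) (at x)"
      using Suc.prems that frechet_derivative_works[of f] by auto
  qed
  then have e: "frechet_derivative (\<lambda>x. L (f x)) (at x) v = L (frechet_derivative f (at x) v)"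
    if "x \<in> S" for x v
    using frechet_derivative_at that by metis
  have "Ck_on k S (\<lambda>x. frechet_derivative (\<lambda>x. L (f x)) (at x) v)" for v
    by (rule Ck_on_cong[OF assms(1), of "\<lambda>x. L (frechet_derivative f (at x) v)"])
      (use e Suc in auto)
  then show ?case
    using h by (auto simp: differentiable_def)
qed

text \<open>\<open>Ck_on\<close> controls derivatives of \<open>f\<close> in fixed directions only,
  whereas the chain rule feeds a varying vector, the derivative of \<open>T\<close>, into the
  derivative of \<open>f\<close>. Expanding this vector in \<open>Basis\<close> leaves fixed
  directions with coefficients of order \<open>k\<close>, to which products, sums and the induction
  hypothesis apply.\<close>

lemma Ck_on_compose:
  fixes T :: "'a::euclidean_space \<Rightarrow> 'b::euclidean_space"
    and f :: "'b \<Rightarrow> 'c::real_normed_vector"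
  assumes "open S" "open S'" "T ` S \<subseteq> S'" "Ck_on k S T" "Ck_on k S' f"
  shows "Ck_on k S (\<lambda>x. f (T x))"
  using assms(4,5)
proof (induction k arbitrary: f)
  case 0
  then show ?case
    using assms(3) by (auto intro: continuous_on_compose2)
next
  case (Suc k)
  have h: "((\<lambda>x. f (T x)) has_derivative
      (\<lambda>v. frechet_derivative f (at (T x)) (frechet_derivative T (at x) v))) (at x)"
    if "x \<in> S" for x
  proof -
    have "T differentiable (at x)" "f differentiable (at (T x))"
      using Suc.prems that assms(3) by auto
    then show ?thesis
      using diff_chain_at[of T "frechet_derivative T (at x)" x f "frechet_derivative f (at (T x))"]
      by (simp add: frechet_derivative_works o_def)
  qed
  have e: "frechet_derivative (\<lambda>x. f (T x)) (at x) v
      = (\<Sum>b\<in>Basis. (frechet_derivative T (at x) v \<bullet> b) *\<^sub>R frechet_derivative f (at (T x)) b)"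
    if x: "x \<in> S" for x v
  proof -
    have "linear (frechet_derivative f (at (T x)))"
      using Suc.prems x assms(3) by (intro linear_frechet_derivative) auto
    moreover have "frechet_derivative (\<lambda>x. f (T x)) (at x) v
        = frechet_derivative f (at (T x)) (frechet_derivative T (at x) v)"
      using frechet_derivative_at[OF h[OF x], symmetric] by simp
    ultimately show ?thesis
      by (subst (asm) euclidean_representation[symmetric, of "frechet_derivative T (at x) v"])
        (simp add: linear_sum linear_scale del: euclidean_representation)
  qed
  have 1: "Ck_on k S (\<lambda>x. frechet_derivative f (at (T x)) b)" for b
    using Suc.IH[of "\<lambda>y. frechet_derivative f (at y) b"] Suc.prems Ck_on_SucD by auto
  have 2: "Ck_on k S (\<lambda>x. frechet_derivative T (at x) v \<bullet> b)" for v b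
    using Ck_on_bounded_linear_compose[OF assms(1) bounded_linear_inner_left[of b],
        of k "\<lambda>x. frechet_derivative T (at x) v"] Suc.prems by simp
  have "Ck_on k S (\<lambda>x. \<Sum>b\<in>Basis.
      (frechet_derivative T (at x) v \<bullet> b) *\<^sub>R frechet_derivative f (at (T x)) b)" for v
    by (rule Ck_on_sum[OF assms(1) finite_Basis Ck_on_scaleR[OF assms(1) 2 1]])
  then have "Ck_on k S (\<lambda>x. frechet_derivative (\<lambda>x. f (T x)) (at x) v)" for v
    by (rule Ck_on_cong[OF assms(1), rotated]) (rule e[symmetric])
  moreover have "(\<lambda>x. f (T x)) differentiable (at x)" if "x \<in> S" for x
    using h[OF that] unfolding differentiable_def by blast
  ultimately show ?case by simp
qed

text \<open>Meant for the exponent -1/2, which normalises a field in the Gram-Schmidt step. The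
  exponent is general because differentiation lowers it by one.\<close>

lemma Ck_on_powr: "Ck_on k {0<..} (\<lambda>x::real. x powr a)"
proof (induction k arbitrary: a)
  case 0
  then show ?case by (auto intro!: continuous_intros)
next
  case (Suc k)
  have h: "((\<lambda>x. x powr a) has_derivative (\<lambda>v. (a * x powr (a - 1)) * v)) (at x)" if "x > 0" for x :: real
    using has_real_derivative_powr[OF that, of a] by (simp add: has_field_derivative_def)
  then have e: "frechet_derivative (\<lambda>x. x powr a) (at x) v = (v * a) * x powr (a - 1)"
    if "x > 0" for x v :: real
    using frechet_derivative_at[OF h[OF that], symmetric] by simp
  have "Ck_on k {0<..} (\<lambda>x::real. (v * a) * x powr (a - 1))" for v
    using Ck_on_scaleR[OF _ Ck_on_const[of k _ "v * a"] Suc[of "a - 1"]] by simp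
  then have "Ck_on k {0<..} (\<lambda>x::real. frechet_derivative (\<lambda>x. x powr a) (at x) v)" for v
    by (rule Ck_on_cong[rotated 2]) (auto simp: e)
  moreover have "(\<lambda>x::real. x powr a) differentiable (at x)" if "x \<in> {0<..}" for x
    using h[of x] that unfolding differentiable_def by auto
  ultimately show ?case by simp
qed

lemma smooth_on_subset: "smooth_on S f \<Longrightarrow> T \<subseteq> S \<Longrightarrow> smooth_on T f"
  using Ck_on_subset unfolding smooth_on_def by blast

lemma smooth_on_cong:
  assumes "open S" "\<And>x. x \<in> S \<Longrightarrow> f x = f' x" "smooth_on S f"
  shows "smooth_on S f'"
  using Ck_on_cong[of S f f'] assms unfolding smooth_on_def by blast

lemma smooth_on_differentiable: "smooth_on S f \<Longrightarrow> x \<in> S \<Longrightarrow> f differentiable (at x)"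
  unfolding smooth_on_def by (metis Ck_on.simps(2))

lemma smooth_on_continuous: "smooth_on S f \<Longrightarrow> continuous_on S f"
  unfolding smooth_on_def by (metis Ck_on.simps(1))

lemma smooth_on_frechet_derivative:
  "smooth_on S f \<Longrightarrow> smooth_on S (\<lambda>x. frechet_derivative f (at x) v)"
  unfolding smooth_on_def by (metis Ck_on.simps(2))

lemma smooth_on_compose:
  fixes T :: "'a::euclidean_space \<Rightarrow> 'b::euclidean_space"
  assumes "open S" "open S'" "T ` S \<subseteq> S'" "smooth_on S T" "smooth_on S' f"
  shows "smooth_on S (\<lambda>x. f (T x))"
  using Ck_on_compose[OF assms(1-3)] assms(4,5) unfolding smooth_on_def by blast

lemma has_derivative_frechet:
  "f differentiable (at x) \<Longrightarrow> (f has_derivative frechet_derivative f (at x)) (at x)"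
  by (simp add: frechet_derivative_works)

section \<open>Functions and tangent vectors on a manifold\<close>

text \<open>For fixed \<open>\<xi>\<close> this is the field with constant coefficients
  \<open>\<xi>\<close> in the chart, so the same term serves as a tangent vector and as its
  extension to the chart domain.\<close>

definition coord_vec ::
  "('a::topological_space, 'n::finite) atlas \<Rightarrow> 'a set \<Rightarrow> ('a \<Rightarrow> real ^ 'n) \<Rightarrow> real ^ 'n \<Rightarrow> 'a field"
  where "coord_vec A W \<phi> \<xi> p = (\<lambda>h.
    if smooth_at A p h then frechet_derivative (h \<circ> inv_into W \<phi>) (at (\<phi> p)) \<xi> else 0)"

lemma tangent_space_iff:
  "v \<in> tangent_space A p \<longleftrightarrow> (\<exists>W \<phi> \<xi>. (W, \<phi>) \<in> A \<and> p \<in> W \<and> v = coord_vec A W \<phi> \<xi> p)"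
  unfolding tangent_space_def coord_vec_def by auto

locale manifold =
  fixes A :: "('a::{t2_space, second_countable_topology}, 'n::finite) atlas"
  assumes atlas: "smooth_atlas A"
begin

lemma chart_exists: obtains W \<phi> where "(W, \<phi>) \<in> A" "p \<in> W"
proof -
  have "p \<in> (\<Union>(W, \<phi>)\<in>A. W)"
    using atlas unfolding smooth_atlas_def by simp
  then show ?thesis using that by auto
qed

lemma
  assumes "(W, \<phi>) \<in> A"
  shows chart_open: "open W"
    and chart_image_open: "open (\<phi> ` W)"
    and chart_homeomorphism: "homeomorphism W (\<phi> ` W) \<phi> (inv_into W \<phi>)"
  using atlas assms unfolding smooth_atlas_def by fast+

lemma chart_inv: "(W, \<phi>) \<in> A \<Longrightarrow> q \<in> W \<Longrightarrow> inv_into W \<phi> (\<phi> q) = q"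
  using chart_homeomorphism[of W \<phi>] by (simp add: homeomorphism_def)

lemma chart_continuous: "(W, \<phi>) \<in> A \<Longrightarrow> continuous_on W \<phi>"
  using chart_homeomorphism[of W \<phi>] by (simp add: homeomorphism_def)

lemma chart_image_Int_open:
  assumes "(W, \<phi>) \<in> A" "open U"
  shows "open (\<phi> ` (U \<inter> W))"
proof -
  have "openin (top_of_set W) (U \<inter> W)"
    using assms by (auto simp: openin_open)
  then have "openin (top_of_set (\<phi> ` W)) (\<phi> ` (U \<inter> W))"
    using homeomorphism_imp_open_map[OF chart_homeomorphism[OF assms(1)]] by blast
  then show ?thesis
    using chart_image_open[OF assms(1)] openin_open_trans by blast
qed

lemma transition_smooth:
  assumes "(W, \<phi>) \<in> A" "(W', \<phi>') \<in> A"
  shows "smooth_on (\<phi> ` (W \<inter> W')) (\<phi>' \<circ> inv_into W \<phi>)"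
  using atlas assms unfolding smooth_atlas_def by fast

section \<open>Smooth functions on open sets and near a point\<close>

lemma smooth_funD:
  "smooth_fun A U f \<Longrightarrow> (W, \<phi>) \<in> A \<Longrightarrow> smooth_on (\<phi> ` (U \<inter> W)) (f \<circ> inv_into W \<phi>)"
  unfolding smooth_fun_def by fast

lemma smooth_fun_subset:
  assumes "smooth_fun A U f" "U' \<subseteq> U"
  shows "smooth_fun A U' f"
  unfolding smooth_fun_def
proof clarify
  fix W \<phi> assume W: "(W, \<phi>) \<in> A"
  show "smooth_on (\<phi> ` (U' \<inter> W)) (f \<circ> inv_into W \<phi>)"
    by (rule smooth_on_subset[OF smooth_funD[OF assms(1) W]]) (use assms(2) in auto)
qed

lemma smooth_fun_cong:
  assumes "open U" "\<And>q. q \<in> U \<Longrightarrow> f q = f' q" "smooth_fun A U f"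
  shows "smooth_fun A U f'"
  unfolding smooth_fun_def
proof clarify
  fix W \<phi> assume W: "(W, \<phi>) \<in> A"
  show "smooth_on (\<phi> ` (U \<inter> W)) (f' \<circ> inv_into W \<phi>)"
    by (rule smooth_on_cong[OF chart_image_Int_open[OF W assms(1)] _ smooth_funD[OF assms(3) W]])
      (auto simp: chart_inv[OF W] assms(2))
qed

lemma smooth_fun_const: "smooth_fun A U (\<lambda>q. c)"
  by (auto simp: smooth_fun_def smooth_on_def Ck_on_const o_def)

lemma smooth_fun_add:
  assumes "open U" "smooth_fun A U f" "smooth_fun A U f'"
  shows "smooth_fun A U (\<lambda>q. f q + f' q)"
  using assms chart_image_Int_open[OF _ assms(1)]
  by (fastforce simp: smooth_fun_def smooth_on_def o_def intro!: Ck_on_add)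

lemma smooth_fun_mult:
  assumes "open U" "smooth_fun A U f" "smooth_fun A U f'"
  shows "smooth_fun A U (\<lambda>q. f q * f' q)"
  unfolding smooth_fun_def smooth_on_def
proof clarify
  fix W \<phi> k assume W: "(W, \<phi>) \<in> A"
  show "Ck_on k (\<phi> ` (U \<inter> W)) ((\<lambda>q. f q * f' q) \<circ> inv_into W \<phi>)"
    using Ck_on_scaleR[OF chart_image_Int_open[OF W assms(1)],
        of k "f \<circ> inv_into W \<phi>" "f' \<circ> inv_into W \<phi>"]
      smooth_funD[OF assms(2) W] smooth_funD[OF assms(3) W]
    by (simp add: smooth_on_def o_def)
qed

lemma smooth_fun_compose:
  fixes F :: "real \<Rightarrow> real"
  assumes "open U" "smooth_fun A U f" "open S" "f ` U \<subseteq> S" "smooth_on S F"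
  shows "smooth_fun A U (\<lambda>q. F (f q))"
  unfolding smooth_fun_def
proof clarify
  fix W \<phi> assume W: "(W, \<phi>) \<in> A"
  have "smooth_on (\<phi> ` (U \<inter> W)) (\<lambda>y. F ((f \<circ> inv_into W \<phi>) y))"
    by (rule smooth_on_compose[OF chart_image_Int_open[OF W assms(1)] assms(3) _
          smooth_funD[OF assms(2) W] assms(5)])
      (use assms(4) chart_inv[OF W] in auto)
  then show "smooth_on (\<phi> ` (U \<inter> W)) ((\<lambda>q. F (f q)) \<circ> inv_into W \<phi>)"
    by (simp add: o_def)
qed

lemma smooth_fun_continuous_on:
  assumes "open U" "smooth_fun A U f"
  shows "continuous_on U f"
proof (rule continuous_at_imp_continuous_on, rule ballI)
  fix p assume p: "p \<in> U"
  obtain W \<phi> where W: "(W, \<phi>) \<in> A" "p \<in> W" by (rule chart_exists)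
  have "continuous_on (\<phi> ` (U \<inter> W)) (f \<circ> inv_into W \<phi>)"
    using smooth_funD[OF assms(2) W(1)] by (rule smooth_on_continuous)
  then have "continuous_on (U \<inter> W) (\<lambda>q. (f \<circ> inv_into W \<phi>) (\<phi> q))"
    by (rule continuous_on_compose2)
      (auto intro: continuous_on_subset[OF chart_continuous[OF W(1)]])
  then have "continuous_on (U \<inter> W) f"
    by (rule continuous_on_eq) (simp add: chart_inv[OF W(1)])
  then show "isCont f p"
    using assms(1) p W chart_open[OF W(1)] by (simp add: continuous_on_eq_continuous_at open_Int)
qed

lemma smooth_atI: "open U \<Longrightarrow> p \<in> U \<Longrightarrow> smooth_fun A U h \<Longrightarrow> smooth_at A p h"
  unfolding smooth_at_def by blast

lemma smooth_at_common:
  assumes "smooth_at A p h" "smooth_at A p h'"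
  obtains U where "open U" "p \<in> U" "smooth_fun A U h" "smooth_fun A U h'"
proof -
  obtain U U' where "open U" "p \<in> U" "smooth_fun A U h" "open U'" "p \<in> U'" "smooth_fun A U' h'"
    using assms unfolding smooth_at_def by blast
  then show ?thesis
    using that[of "U \<inter> U'"] smooth_fun_subset by (metis IntI inf_le1 inf_le2 open_Int)
qed

lemma smooth_at_cong:
  assumes "open U" "p \<in> U" "\<And>q. q \<in> U \<Longrightarrow> h q = h' q" "smooth_at A p h"
  shows "smooth_at A p h'"
proof -
  obtain U' where U': "open U'" "p \<in> U'" "smooth_fun A U' h"
    using assms(4) unfolding smooth_at_def by blast
  have "smooth_fun A (U \<inter> U') h'"
    by (rule smooth_fun_cong[of _ h]) (use U' assms smooth_fun_subset in auto)
  then show ?thesis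
    using U' assms by (intro smooth_atI[of "U \<inter> U'"]) auto
qed

lemma smooth_at_differentiable:
  assumes "(W, \<phi>) \<in> A" "p \<in> W" "smooth_at A p h"
  shows "(h \<circ> inv_into W \<phi>) differentiable (at (\<phi> p))"
  using assms smooth_on_differentiable[OF smooth_funD[OF _ assms(1)]]
  unfolding smooth_at_def by blast

section \<open>Tangent vectors in coordinates\<close>

lemma coord_vec_add:
  assumes "(W, \<phi>) \<in> A" "p \<in> W"
  shows "coord_vec A W \<phi> (\<xi> + \<eta>) p = (\<lambda>h. coord_vec A W \<phi> \<xi> p h + coord_vec A W \<phi> \<eta> p h)"
  using linear_frechet_derivative[OF smooth_at_differentiable[OF assms]]
  by (auto simp: coord_vec_def linear_add)

lemma coord_vec_scale:
  assumes "(W, \<phi>) \<in> A" "p \<in> W"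
  shows "coord_vec A W \<phi> (c *\<^sub>R \<xi>) p = (\<lambda>h. c * coord_vec A W \<phi> \<xi> p h)"
  using linear_frechet_derivative[OF smooth_at_differentiable[OF assms]]
  by (auto simp: coord_vec_def linear_scale)

lemma coord_vec_zero:
  assumes "(W, \<phi>) \<in> A" "p \<in> W"
  shows "coord_vec A W \<phi> 0 p = (\<lambda>h. 0)"
  using coord_vec_scale[OF assms, of 0 0] by simp

lemma coord_vec_sum:
  assumes "(W, \<phi>) \<in> A" "p \<in> W" "finite I"
  shows "coord_vec A W \<phi> (\<Sum>i\<in>I. c i *\<^sub>R \<xi> i) p = (\<lambda>h. \<Sum>i\<in>I. c i * coord_vec A W \<phi> (\<xi> i) p h)"
  using assms(3)
  by (induction I rule: finite_induct)
    (simp_all add: coord_vec_zero[OF assms(1,2)] coord_vec_add[OF assms(1,2)]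
      coord_vec_scale[OF assms(1,2)])

text \<open>The value on the i-th coordinate function is the component \<open>\<xi> $ i\<close>,
  since in its own chart this function is a linear projection. The transition maps make it smooth on
  \<open>W\<close>, so the default value 0 does not interfere.\<close>

lemma coord_vec_eq_0_iff:
  assumes W: "(W, \<phi>) \<in> A" "p \<in> W"
  shows "coord_vec A W \<phi> \<xi> p = (\<lambda>h. 0) \<longleftrightarrow> \<xi> = 0"
proof
  assume 0: "coord_vec A W \<phi> \<xi> p = (\<lambda>h. 0)"
  have "\<xi> $ i = 0" for i
  proof -
    have b: "bounded_linear (\<lambda>x::real^'n. x $ i)"
      by (rule bounded_linear_vec_nth)
    have "smooth_fun A W (\<lambda>q. \<phi> q $ i)"
      unfolding smooth_fun_def smooth_on_def
    proof clarify
      fix W' \<phi>' k assume W': "(W', \<phi>') \<in> A"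
      show "Ck_on k (\<phi>' ` (W \<inter> W')) ((\<lambda>q. \<phi> q $ i) \<circ> inv_into W' \<phi>')"
        using Ck_on_bounded_linear_compose[OF chart_image_Int_open[OF W' chart_open[OF W(1)]] b]
          transition_smooth[OF W' W(1)]
        by (simp add: smooth_on_def o_def Int_commute)
    qed
    then have s: "smooth_at A p (\<lambda>q. \<phi> q $ i)"
      using W chart_open by (intro smooth_atI[of W]) auto
    have "((\<lambda>q. \<phi> q $ i) \<circ> inv_into W \<phi> has_derivative (\<lambda>x. x $ i)) (at (\<phi> p))"
      by (rule has_derivative_transform_within_open[OF bounded_linear_imp_has_derivative[OF b]
            chart_image_open[OF W(1)]]) (use W chart_inv in auto)
    then have "frechet_derivative ((\<lambda>q. \<phi> q $ i) \<circ> inv_into W \<phi>) (at (\<phi> p)) = (\<lambda>x. x $ i)"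
      using frechet_derivative_at by metis
    then show ?thesis
      using fun_cong[OF 0, of "\<lambda>q. \<phi> q $ i"] s by (simp add: coord_vec_def)
  qed
  then show "\<xi> = 0" by (simp add: vec_eq_iff)
qed (simp add: coord_vec_zero[OF W])

text \<open>Membership in \<open>tangent_space\<close> yields only some chart around
  \<open>p\<close>. The derivative of the transition map carries the components to a prescribed
  chart, so that linear algebra at \<open>p\<close> can be done in a single copy of
  \<open>real ^ 'n\<close>.\<close>

lemma tangent_space_chart:
  assumes W: "(W, \<phi>) \<in> A" "p \<in> W" and v: "v \<in> tangent_space A p"
  obtains \<xi> where "v = coord_vec A W \<phi> \<xi> p"
proof -
  obtain W' \<phi>' \<xi>' where W': "(W', \<phi>') \<in> A" "p \<in> W'" and v: "v = coord_vec A W' \<phi>' \<xi>' p"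
    using v unfolding tangent_space_iff by blast
  let ?T = "\<phi> \<circ> inv_into W' \<phi>'"
  have T: "?T differentiable (at (\<phi>' p))"
    using smooth_on_differentiable[OF transition_smooth[OF W'(1) W(1)]] W W' by blast
  have "frechet_derivative (h \<circ> inv_into W' \<phi>') (at (\<phi>' p)) \<xi>'
      = frechet_derivative (h \<circ> inv_into W \<phi>) (at (\<phi> p)) (frechet_derivative ?T (at (\<phi>' p)) \<xi>')"
    if h: "smooth_at A p h" for h
  proof -
    have Tp: "?T (\<phi>' p) = \<phi> p" using chart_inv[OF W'] by simp
    have "((h \<circ> inv_into W \<phi>) \<circ> ?T has_derivative
        frechet_derivative (h \<circ> inv_into W \<phi>) (at (\<phi> p)) \<circ> frechet_derivative ?T (at (\<phi>' p)))
        (at (\<phi>' p))"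
      using diff_chain_at[OF has_derivative_frechet[OF T]] Tp
        has_derivative_frechet[OF smooth_at_differentiable[OF W h]] by simp
    then have "(h \<circ> inv_into W' \<phi>' has_derivative
        frechet_derivative (h \<circ> inv_into W \<phi>) (at (\<phi> p)) \<circ> frechet_derivative ?T (at (\<phi>' p)))
        (at (\<phi>' p))"
      by (rule has_derivative_transform_within_open[OF _
            chart_image_Int_open[OF W'(1) chart_open[OF W(1)]]])
        (use W W' chart_inv in auto)
    then show ?thesis
      using frechet_derivative_at[symmetric] by (metis comp_apply)
  qed
  then have "v = coord_vec A W \<phi> (frechet_derivative ?T (at (\<phi>' p)) \<xi>') p"
    unfolding v coord_vec_def by auto
  then show ?thesis by (rule that)
qed

lemma coord_vec_tangent: "(W, \<phi>) \<in> A \<Longrightarrow> p \<in> W \<Longrightarrow> coord_vec A W \<phi> \<xi> p \<in> tangent_space A p"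
  unfolding tangent_space_iff by blast

section \<open>The vector space structure of a tangent space\<close>

lemma tangent_zero: "(\<lambda>h. 0) \<in> tangent_space A p"
proof -
  obtain W \<phi> where W: "(W, \<phi>) \<in> A" "p \<in> W" by (rule chart_exists)
  then show ?thesis
    using coord_vec_tangent[OF W, of 0] by (simp add: coord_vec_zero[OF W])
qed

lemma tangent_add:
  assumes "v \<in> tangent_space A p" "w \<in> tangent_space A p"
  shows "(\<lambda>h. v h + w h) \<in> tangent_space A p"
proof -
  obtain W \<phi> where W: "(W, \<phi>) \<in> A" "p \<in> W" by (rule chart_exists)
  obtain \<xi> \<eta> where "v = coord_vec A W \<phi> \<xi> p" "w = coord_vec A W \<phi> \<eta> p"
    using tangent_space_chart[OF W assms(1)] tangent_space_chart[OF W assms(2)] by metis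
  then show ?thesis
    using coord_vec_tangent[OF W, of "\<xi> + \<eta>"] by (simp add: coord_vec_add[OF W])
qed

lemma tangent_scale:
  assumes "v \<in> tangent_space A p"
  shows "(\<lambda>h. c * v h) \<in> tangent_space A p"
proof -
  obtain W \<phi> where W: "(W, \<phi>) \<in> A" "p \<in> W" by (rule chart_exists)
  obtain \<xi> where "v = coord_vec A W \<phi> \<xi> p"
    using tangent_space_chart[OF W assms] .
  then show ?thesis
    using coord_vec_tangent[OF W, of "c *\<^sub>R \<xi>"] by (simp add: coord_vec_scale[OF W])
qed

lemma tangent_sum:
  assumes "finite I" "\<And>i. i \<in> I \<Longrightarrow> v i \<in> tangent_space A p"
  shows "(\<lambda>h. \<Sum>i\<in>I. c i * v i h) \<in> tangent_space A p"
  using assms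
  by (induction I rule: finite_induct) (simp_all add: tangent_zero tangent_add tangent_scale)

text \<open>Smoothness at \<open>p\<close> depends on the germ only, so either both functions are
  differentiated or both receive the default value 0. Many identities below hold on \<open>U\<close>
  alone, and this allows their use under a derivative.\<close>

lemma tangent_cong:
  assumes v: "v \<in> tangent_space A p" and U: "open U" "p \<in> U" and h: "\<And>q. q \<in> U \<Longrightarrow> h q = h' q"
  shows "v h = v h'"
proof -
  obtain W \<phi> \<xi> where W: "(W, \<phi>) \<in> A" "p \<in> W" and v: "v = coord_vec A W \<phi> \<xi> p"
    using v unfolding tangent_space_iff by blast
  have "smooth_at A p h \<longleftrightarrow> smooth_at A p h'"
    using smooth_at_cong[OF U, of h h'] smooth_at_cong[OF U, of h' h] h by auto
  moreover have "frechet_derivative (h \<circ> inv_into W \<phi>) (at (\<phi> p))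
      = frechet_derivative (h' \<circ> inv_into W \<phi>) (at (\<phi> p))"
    by (rule frechet_derivative_cong_open[OF chart_image_Int_open[OF W(1) U(1)]])
      (use W U h chart_inv in auto)
  ultimately show ?thesis
    unfolding v coord_vec_def by simp
qed

lemma tangent_fun_add:
  assumes v: "v \<in> tangent_space A p" and h: "smooth_at A p h" "smooth_at A p h'"
  shows "v (\<lambda>q. h q + h' q) = v h + v h'"
proof -
  obtain W \<phi> \<xi> where W: "(W, \<phi>) \<in> A" "p \<in> W" and v: "v = coord_vec A W \<phi> \<xi> p"
    using v unfolding tangent_space_iff by blast
  have "smooth_at A p (\<lambda>q. h q + h' q)"
    using smooth_at_common[OF h] smooth_fun_add by (metis smooth_atI)
  moreover have "((\<lambda>q. h q + h' q) \<circ> inv_into W \<phi> has_derivative (\<lambda>\<xi>.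
      frechet_derivative (h \<circ> inv_into W \<phi>) (at (\<phi> p)) \<xi>
      + frechet_derivative (h' \<circ> inv_into W \<phi>) (at (\<phi> p)) \<xi>)) (at (\<phi> p))"
    using has_derivative_add[OF has_derivative_frechet[OF smooth_at_differentiable[OF W h(1)]]
      has_derivative_frechet[OF smooth_at_differentiable[OF W h(2)]]] by (simp add: o_def)
  ultimately show ?thesis
    using h frechet_derivative_at[symmetric] unfolding v coord_vec_def by fastforce
qed

lemma tangent_fun_mult:
  assumes v: "v \<in> tangent_space A p" and h: "smooth_at A p h" "smooth_at A p h'"
  shows "v (\<lambda>q. h q * h' q) = h p * v h' + v h * h' p"
proof -
  obtain W \<phi> \<xi> where W: "(W, \<phi>) \<in> A" "p \<in> W" and v: "v = coord_vec A W \<phi> \<xi> p"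
    using v unfolding tangent_space_iff by blast
  have "smooth_at A p (\<lambda>q. h q * h' q)"
    using smooth_at_common[OF h] smooth_fun_mult by (metis smooth_atI)
  moreover have "((\<lambda>q. h q * h' q) \<circ> inv_into W \<phi> has_derivative (\<lambda>\<xi>.
      h p * frechet_derivative (h' \<circ> inv_into W \<phi>) (at (\<phi> p)) \<xi>
      + frechet_derivative (h \<circ> inv_into W \<phi>) (at (\<phi> p)) \<xi> * h' p)) (at (\<phi> p))"
    using has_derivative_mult[OF has_derivative_frechet[OF smooth_at_differentiable[OF W h(1)]]
      has_derivative_frechet[OF smooth_at_differentiable[OF W h(2)]]] chart_inv[OF W]
    by (simp add: o_def)
  ultimately show ?thesis
    using h frechet_derivative_at[symmetric] unfolding v coord_vec_def by fastforce
qed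

lemma tangent_fun_const:
  assumes v: "v \<in> tangent_space A p"
  shows "v (\<lambda>q. c) = 0"
proof -
  obtain W \<phi> \<xi> where W: "(W, \<phi>) \<in> A" "p \<in> W" and v: "v = coord_vec A W \<phi> \<xi> p"
    using v unfolding tangent_space_iff by blast
  show ?thesis
    unfolding v coord_vec_def by (simp add: o_def)
qed

lemma tangent_fun_minus:
  assumes v: "v \<in> tangent_space A p" and h: "smooth_at A p h"
  shows "v (\<lambda>q. - h q) = - v h"
  using tangent_fun_mult[OF v smooth_atI[OF open_UNIV UNIV_I smooth_fun_const[of _ "-1"]] h]
  by (simp add: tangent_fun_const[OF v])

lemma smooth_at_minus:
  assumes "smooth_at A p h" shows "smooth_at A p (\<lambda>q. - h q)"
proof -
  obtain U where "open U" "p \<in> U" "smooth_fun A U h"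
    using assms unfolding smooth_at_def by blast
  then show ?thesis
    using smooth_fun_mult[OF _ smooth_fun_const[of _ "-1"], of U h] by (auto intro: smooth_atI)
qed

lemma tangent_fun_diff:
  assumes "v \<in> tangent_space A p" "smooth_at A p h" "smooth_at A p h'"
  shows "v (\<lambda>q. h q - h' q) = v h - v h'"
  using tangent_fun_add[OF assms(1,2) smooth_at_minus[OF assms(3)]]
  by (simp add: tangent_fun_minus[OF assms(1,3)])

lemma tangent_fun_sum:
  assumes "v \<in> tangent_space A p" "finite I" "open U" "p \<in> U" "\<And>i. i \<in> I \<Longrightarrow> smooth_fun A U (h i)"
  shows "v (\<lambda>q. \<Sum>i\<in>I. h i q) = (\<Sum>i\<in>I. v (h i)) \<and> smooth_fun A U (\<lambda>q. \<Sum>i\<in>I. h i q)"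
  using assms(2,5)
proof (induction I rule: finite_induct)
  case empty
  then show ?case using tangent_fun_const[OF assms(1)] smooth_fun_const by simp
next
  case (insert i I)
  then show ?case
    using tangent_fun_add[OF assms(1), of "h i" "\<lambda>q. \<Sum>i\<in>I. h i q"] assms
    by (auto intro: smooth_atI smooth_fun_add)
qed


section \<open>Vector fields\<close>

lemma
  assumes "vector_field_on A U X"
  shows vector_field_open: "open U"
    and vector_field_tangent: "p \<in> U \<Longrightarrow> X p \<in> tangent_space A p"
    and vector_field_smooth:
      "open U' \<Longrightarrow> U' \<subseteq> U \<Longrightarrow> smooth_fun A U' h \<Longrightarrow> smooth_fun A U' (\<lambda>q. X q h)"
  using assms unfolding vector_field_on_def by auto

lemma vector_field_restrict:
  "vector_field_on A U X \<Longrightarrow> open U' \<Longrightarrow> U' \<subseteq> U \<Longrightarrow> vector_field_on A U' X"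
  unfolding vector_field_on_def by (meson order_trans subset_iff)

lemma vector_field_cong:
  assumes "vector_field_on A U X" "\<And>q. q \<in> U \<Longrightarrow> X q = X' q"
  shows "vector_field_on A U X'"
  unfolding vector_field_on_def
proof (intro conjI ballI allI impI)
  show "open U" using vector_field_open[OF assms(1)] .
  show "X' p \<in> tangent_space A p" if "p \<in> U" for p
    using vector_field_tangent[OF assms(1) that] assms(2)[OF that] by simp
  show "smooth_fun A W (\<lambda>q. X' q h)" if "open W \<and> W \<subseteq> U \<and> smooth_fun A W h" for W h
  proof (rule smooth_fun_cong)
    show "open W" "smooth_fun A W (\<lambda>q. X q h)"
      using that vector_field_smooth[OF assms(1)] by auto
    show "X q h = X' q h" if "q \<in> W" for q
      using \<open>open W \<and> W \<subseteq> U \<and> smooth_fun A W h\<close> that assms(2)[of q] by auto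
  qed
qed

lemma vector_field_add:
  assumes "vector_field_on A U X" "vector_field_on A U Y"
  shows "vector_field_on A U (\<lambda>q h. X q h + Y q h)"
  using assms unfolding vector_field_on_def by (auto intro: tangent_add smooth_fun_add)

lemma vector_field_mult:
  assumes "smooth_fun A U f" "vector_field_on A U X"
  shows "vector_field_on A U (\<lambda>q h. f q * X q h)"
  using assms unfolding vector_field_on_def
  by (auto intro: tangent_scale smooth_fun_mult smooth_fun_subset)

lemma vector_field_diff:
  assumes "vector_field_on A U X" "vector_field_on A U Y"
  shows "vector_field_on A U (\<lambda>q h. X q h - Y q h)"
  using vector_field_add[OF assms(1) vector_field_mult[OF smooth_fun_const[of _ "-1"] assms(2)]]
  by simp

lemma vector_field_zero: "open U \<Longrightarrow> vector_field_on A U (\<lambda>q h. 0)"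
  unfolding vector_field_on_def by (simp add: tangent_zero smooth_fun_const)

lemma vector_field_sum:
  assumes "open U" "finite I" "\<And>i. i \<in> I \<Longrightarrow> smooth_fun A U (f i)"
    "\<And>i. i \<in> I \<Longrightarrow> vector_field_on A U (X i)"
  shows "vector_field_on A U (\<lambda>q h. \<Sum>i\<in>I. f i q * X i q h)"
  using assms(2-)
  by (induction I rule: finite_induct)
    (auto simp: vector_field_zero[OF assms(1)] intro!: vector_field_add vector_field_mult)

text \<open>In the chart itself the field differentiates in a fixed direction, which preserves
  smoothness; every other chart sees the result composed with a transition map.\<close>

lemma coord_vec_vector_field:
  assumes W: "(W, \<phi>) \<in> A"
  shows "vector_field_on A W (coord_vec A W \<phi> \<xi>)"
  unfolding vector_field_on_def
proof (intro conjI ballI allI impI)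
  show "open W" by (rule chart_open[OF W])
  show "coord_vec A W \<phi> \<xi> p \<in> tangent_space A p" if "p \<in> W" for p
    by (rule coord_vec_tangent[OF W that])
  fix U h assume U: "open U \<and> U \<subseteq> W \<and> smooth_fun A U h"
  let ?d = "\<lambda>y. frechet_derivative (h \<circ> inv_into W \<phi>) (at y) \<xi>"
  have d: "smooth_on (\<phi> ` (U \<inter> W)) ?d"
    using smooth_on_frechet_derivative[OF smooth_funD[OF _ W]] U by blast
  have s: "coord_vec A W \<phi> \<xi> q h = ?d (\<phi> q)" if "q \<in> U" for q
    using U that smooth_atI[of U q h] by (simp add: coord_vec_def)
  show "smooth_fun A U (\<lambda>q. coord_vec A W \<phi> \<xi> q h)"
    unfolding smooth_fun_def
  proof clarify
    fix W' \<phi>' assume W': "(W', \<phi>') \<in> A"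
    have "smooth_on (\<phi>' ` (U \<inter> W')) (\<lambda>y. ?d ((\<phi> \<circ> inv_into W' \<phi>') y))"
    proof (rule smooth_on_compose[OF _ _ _ _ d])
      show "open (\<phi>' ` (U \<inter> W'))" "open (\<phi> ` (U \<inter> W))"
        using chart_image_Int_open W W' U by auto
      show "(\<phi> \<circ> inv_into W' \<phi>') ` \<phi>' ` (U \<inter> W') \<subseteq> \<phi> ` (U \<inter> W)"
        using U chart_inv[OF W'] by auto
      show "smooth_on (\<phi>' ` (U \<inter> W')) (\<phi> \<circ> inv_into W' \<phi>')"
        by (rule smooth_on_subset[OF transition_smooth[OF W' W]]) (use U in auto)
    qed
    moreover have "?d ((\<phi> \<circ> inv_into W' \<phi>') y) = ((\<lambda>q. coord_vec A W \<phi> \<xi> q h) \<circ> inv_into W' \<phi>') y"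
      if "y \<in> \<phi>' ` (U \<inter> W')" for y
      using that by (auto simp: chart_inv[OF W'] s)
    ultimately show "smooth_on (\<phi>' ` (U \<inter> W')) ((\<lambda>q. coord_vec A W \<phi> \<xi> q h) \<circ> inv_into W' \<phi>')"
      by (rule smooth_on_cong[OF chart_image_Int_open[OF W' conjunct1[OF U]], rotated])
  qed
qed

lemma tangent_extension:
  assumes "v \<in> tangent_space A p"
  obtains U X where "p \<in> U" "vector_field_on A U X" "X p = v"
proof -
  obtain W \<phi> where W: "(W, \<phi>) \<in> A" "p \<in> W" by (rule chart_exists)
  obtain \<xi> where "v = coord_vec A W \<phi> \<xi> p" using tangent_space_chart[OF W assms] .
  then show ?thesis using that[OF W(2) coord_vec_vector_field[OF W(1)]] by simp
qed

text \<open>Balls are convex, so a vanishing derivative makes \<open>f\<close> constant on the part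
  of a chart that corresponds to a ball. Connectedness turns local constancy into constancy.\<close>

lemma constant_if_tangent_derivative_zero:
  assumes "connected (UNIV :: 'a set)" "smooth_fun A UNIV f"
    and 0: "\<And>p v. v \<in> tangent_space A p \<Longrightarrow> v f = 0"
  shows "\<exists>c. \<forall>p. f p = c"
proof -
  have *: "\<exists>U. open U \<and> p \<in> U \<and> (\<forall>q\<in>U. f q = f p)" for p
  proof -
    obtain W \<phi> where W: "(W, \<phi>) \<in> A" "p \<in> W" by (rule chart_exists)
    let ?F = "f \<circ> inv_into W \<phi>"
    obtain e where e: "e > 0" "ball (\<phi> p) e \<subseteq> \<phi> ` W"
      using openE[OF chart_image_open[OF W(1)], of "\<phi> p"] W(2) by blast
    have "(?F has_derivative (\<lambda>\<xi>. 0)) (at y within ball (\<phi> p) e)" if y: "y \<in> ball (\<phi> p) e" for y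
    proof -
      obtain q where q: "q \<in> W" "y = \<phi> q" using e y by blast
      have s: "smooth_at A q f" using assms(2) by (auto intro: smooth_atI[of UNIV])
      have "frechet_derivative ?F (at y) \<xi> = 0" for \<xi>
        using 0[OF coord_vec_tangent[OF W(1) q(1), of \<xi>]] s q by (simp add: coord_vec_def)
      then have "frechet_derivative ?F (at y) = (\<lambda>\<xi>. 0)" by auto
      then show ?thesis
        using has_derivative_frechet[OF smooth_at_differentiable[OF W(1) q(1) s]] q
        by (simp add: has_derivative_at_withinI)
    qed
    then obtain c where c: "\<And>y. y \<in> ball (\<phi> p) e \<Longrightarrow> ?F y = c"
      using has_derivative_zero_constant[of "ball (\<phi> p) e" ?F] by auto
    let ?U = "W \<inter> \<phi> -` ball (\<phi> p) e"
    have "open ?U"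
      using continuous_open_preimage[OF chart_continuous[OF W(1)] chart_open[OF W(1)] open_ball] .
    moreover have "f q = c" if "q \<in> ?U" for q
      using c[of "\<phi> q"] that chart_inv[OF W(1)] by simp
    moreover have "p \<in> ?U" using W e by simp
    ultimately show ?thesis by metis
  qed
  have "f constant_on UNIV"
    by (rule locally_constant_imp_constant[OF assms(1)]) (use * in auto)
  then show ?thesis by (auto simp: constant_on_def)
qed

end

section \<open>Orthonormal frames\<close>

locale riemannian = manifold A
  for A :: "('a::{t2_space, second_countable_topology}, 'n::finite) atlas" +
  fixes g :: "'a metric"
  assumes metric: "riemannian_metric A g"
begin

lemma
  assumes "x \<in> tangent_space A p" "y \<in> tangent_space A p"
  shows g_sym: "g p x y = g p y x"
    and g_add_left: "z \<in> tangent_space A p \<Longrightarrow> g p (\<lambda>h. x h + y h) z = g p x z + g p y z"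
    and g_scale_left: "g p (\<lambda>h. c * x h) y = c * g p x y"
  using metric assms unfolding riemannian_metric_def by blast+

lemma g_pos: "x \<in> tangent_space A p \<Longrightarrow> x \<noteq> (\<lambda>h. 0) \<Longrightarrow> g p x x > 0"
  using metric unfolding riemannian_metric_def by blast

lemma g_zero_left: "x \<in> tangent_space A p \<Longrightarrow> g p (\<lambda>h. 0) x = 0"
  using g_scale_left[of x p x 0] by simp

lemma g_diff_left:
  assumes "x \<in> tangent_space A p" "y \<in> tangent_space A p" "z \<in> tangent_space A p"
  shows "g p (\<lambda>h. x h - y h) z = g p x z - g p y z"
  using g_add_left[OF assms(1) tangent_scale[OF assms(2), of "-1"] assms(3)]
    g_scale_left[OF assms(2,3), of "-1"] by simp

lemma g_sum_left:
  assumes "finite I" "\<And>i. i \<in> I \<Longrightarrow> x i \<in> tangent_space A p" "z \<in> tangent_space A p"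
  shows "g p (\<lambda>h. \<Sum>i\<in>I. c i * x i h) z = (\<Sum>i\<in>I. c i * g p (x i) z)"
  using assms(1,2)
proof (induction I rule: finite_induct)
  case empty
  then show ?case using g_zero_left[OF assms(3)] by simp
next
  case (insert i I)
  then show ?case
    using g_add_left[OF tangent_scale[of "x i" p "c i"] tangent_sum[OF insert.hyps(1), of x p c]
        assms(3)] g_scale_left[of "x i" p z "c i"] assms(3)
    by simp
qed

lemma metric_app_smooth:
  "vector_field_on A U X \<Longrightarrow> vector_field_on A U Y \<Longrightarrow> smooth_fun A U (metric_app g X Y)"
  using metric unfolding riemannian_metric_def by blast

lemma orthonormal_frame_vector_field:
  "orthonormal_frame_on A g U E \<Longrightarrow> vector_field_on A U (E i)"
  unfolding orthonormal_frame_on_def by blast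

lemma orthonormal_frame_metric:
  "orthonormal_frame_on A g U E \<Longrightarrow> q \<in> U \<Longrightarrow> g q (E i q) (E j q) = (if i = j then 1 else 0)"
  unfolding orthonormal_frame_on_def metric_app_def by blast

text \<open>Orthonormal vectors are independent, and there are as many of them as coordinates. In a
  chart they define an injective endomorphism \<open>?L\<close> of \<open>real ^ 'n\<close>, which
  is therefore surjective; pairing with \<open>E j\<close> identifies the coefficients.\<close>

lemma orthonormal_frame_expansion:
  assumes E: "orthonormal_frame_on A g U E" and q: "q \<in> U" and x: "x \<in> tangent_space A q"
  shows "x = (\<lambda>h. \<Sum>i\<in>UNIV. g q x (E i q) * E i q h)"
proof -
  have T: "E i q \<in> tangent_space A q" for i
    using vector_field_tangent[OF orthonormal_frame_vector_field[OF E] q] .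
  have coeff: "g q (\<lambda>h. \<Sum>i\<in>UNIV. c i * E i q h) (E j q) = c j" for c :: "'n \<Rightarrow> real" and j
    by (subst g_sum_left)
      (simp_all add: T orthonormal_frame_metric[OF E q] if_distrib[of "\<lambda>t. _ * t"] cong: if_cong)
  obtain W \<phi> where W: "(W, \<phi>) \<in> A" "q \<in> W" by (rule chart_exists)
  have "\<exists>\<xi>. E i q = coord_vec A W \<phi> \<xi> q" for i
    using tangent_space_chart[OF W T] by metis
  then obtain \<xi> where \<xi>: "\<And>i. E i q = coord_vec A W \<phi> (\<xi> i) q" by metis
  let ?L = "\<lambda>c::real^'n. \<Sum>i\<in>UNIV. c $ i *\<^sub>R \<xi> i"
  have lin: "linear ?L"
    by (rule linearI) (auto simp: sum.distrib scaleR_add_left scaleR_sum_right)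
  have "inj ?L"
    unfolding linear_injective_0[OF lin]
  proof (intro allI impI)
    fix c assume "?L c = 0"
    then have 0: "(\<lambda>h. \<Sum>i\<in>UNIV. c $ i * E i q h) = (\<lambda>h. 0)"
      using coord_vec_sum[OF W finite[of UNIV], of "\<lambda>i. c $ i" \<xi>] coord_vec_zero[OF W] by (simp add: \<xi>)
    have "c $ j = 0" for j
      using coeff[of "\<lambda>i. c $ i" j] g_zero_left[OF T] unfolding 0 by simp
    then show "c = 0" by (simp add: vec_eq_iff)
  qed
  then have "surj ?L" by (rule linear_injective_imp_surjective[OF lin _ refl])
  moreover obtain \<eta> where \<eta>: "x = coord_vec A W \<phi> \<eta> q" using tangent_space_chart[OF W x] .
  ultimately obtain c where "\<eta> = ?L c" by (elim surjE)
  then have x_eq: "x = (\<lambda>h. \<Sum>i\<in>UNIV. c $ i * E i q h)"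
    using coord_vec_sum[OF W finite[of UNIV], of "\<lambda>i. c $ i" \<xi>] by (simp add: \<eta> \<xi>)
  then have "g q x (E j q) = c $ j" for j
    using coeff[of "\<lambda>i. c $ i" j] by simp
  then show ?thesis using x_eq by simp
qed

lemma parseval:
  assumes E: "orthonormal_frame_on A g U E" and q: "q \<in> U"
    and x: "x \<in> tangent_space A q" and y: "y \<in> tangent_space A q"
  shows "(\<Sum>i\<in>UNIV. g q x (E i q) * g q y (E i q)) = g q x y"
proof -
  have T: "E i q \<in> tangent_space A q" for i
    using vector_field_tangent[OF orthonormal_frame_vector_field[OF E] q] .
  have "g q x y = g q (\<lambda>h. \<Sum>i\<in>UNIV. g q x (E i q) * E i q h) y"
    using orthonormal_frame_expansion[OF E q x] by metis
  also have "\<dots> = (\<Sum>i\<in>UNIV. g q x (E i q) * g q (E i q) y)"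
    by (rule g_sum_left) (simp_all add: T y)
  finally show ?thesis by (simp add: g_sym[OF T y])
qed

lemma Gram_Schmidt_step:
  fixes E :: "'n \<Rightarrow> 'a field"
  assumes U: "open U" "p \<in> U" and E: "\<And>i. i \<in> S \<Longrightarrow> vector_field_on A U (E i)"
    and on: "\<And>q i j. q \<in> U \<Longrightarrow> i \<in> S \<Longrightarrow> j \<in> S \<Longrightarrow> g q (E i q) (E j q) = (if i = j then 1 else 0)"
    and k: "k \<notin> S"
  obtains U' X where "open U'" "p \<in> U'" "U' \<subseteq> U" "vector_field_on A U' X"
    "\<forall>q\<in>U'. g q (X q) (X q) = 1 \<and> (\<forall>i\<in>S. g q (X q) (E i q) = 0)"
proof -
  obtain W \<phi> where W: "(W, \<phi>) \<in> A" "p \<in> W" by (rule chart_exists)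
  have "\<exists>\<xi>. E i p = coord_vec A W \<phi> \<xi> p" if "i \<in> S" for i
    using tangent_space_chart[OF W vector_field_tangent[OF E[OF that] U(2)]] by metis
  then obtain \<xi> where \<xi>: "\<And>i. i \<in> S \<Longrightarrow> E i p = coord_vec A W \<phi> (\<xi> i) p" by metis
  let ?L = "\<lambda>c::real^'n. \<Sum>i\<in>S. c $ i *\<^sub>R \<xi> i"
  have lin: "linear ?L"
    by (rule linearI) (auto simp: sum.distrib scaleR_add_left scaleR_sum_right)
  \<comment> \<open>The sum runs over \<open>S\<close> only, so \<open>?L\<close> ignores the
    coordinate \<open>k\<close>. An endomorphism of \<open>real ^ 'n\<close> with nonzero kernel
    misses some \<open>\<eta>\<close>, which lies outside the span of the given frame vectors at
    \<open>p\<close>.\<close>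
  have "?L (axis k 1) = 0"
    using k by (intro sum.neutral) (auto simp: axis_def)
  then have "\<not> inj ?L"
    unfolding linear_injective_0[OF lin] by (metis axis_eq_0_iff zero_neq_one)
  then have "\<not> surj ?L" using linear_surjective_imp_injective[OF lin _ refl] by blast
  then obtain \<eta> where \<eta>: "\<eta> \<notin> range ?L" by blast
  let ?U1 = "U \<inter> W"
  let ?C = "coord_vec A W \<phi> \<eta>"
  define c where "c i = metric_app g ?C (E i)" for i
  define Y where "Y = (\<lambda>q h. ?C q h - (\<Sum>i\<in>S. c i q * E i q h))"
  have U1: "open ?U1" "p \<in> ?U1" using U W chart_open by auto
  have C: "vector_field_on A ?U1 ?C"
    using vector_field_restrict[OF coord_vec_vector_field[OF W(1)] U1(1)] by simp
  have E1: "vector_field_on A ?U1 (E i)" if "i \<in> S" for i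
    using vector_field_restrict[OF E[OF that] U1(1)] by simp
  have c: "smooth_fun A ?U1 (c i)" if "i \<in> S" for i
    unfolding c_def by (rule metric_app_smooth[OF C E1[OF that]])
  have Y: "vector_field_on A ?U1 Y"
    unfolding Y_def by (intro vector_field_diff vector_field_sum C E1 c U1) auto
  \<comment> \<open>If the projections cancelled the vector at \<open>p\<close>, its components
    \<open>\<eta>\<close> would lie in the range of \<open>?L\<close>.\<close>
  have "Y p \<noteq> (\<lambda>h. 0)"
  proof
    have "coord_vec A W \<phi> (\<eta> - ?L (\<chi> i. c i p)) p
        = coord_vec A W \<phi> (\<eta> + (-1) *\<^sub>R ?L (\<chi> i. c i p)) p" by simp
    also have "\<dots> = Y p"
      using coord_vec_sum[OF W, of S "\<lambda>i. c i p" \<xi>]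
      by (simp only: coord_vec_add[OF W] coord_vec_scale[OF W]) (simp add: Y_def \<xi>)
    finally have *: "coord_vec A W \<phi> (\<eta> - ?L (\<chi> i. c i p)) p = Y p" .
    assume "Y p = (\<lambda>h. 0)"
    then have "\<eta> - ?L (\<chi> i. c i p) = 0" unfolding *[symmetric] coord_vec_eq_0_iff[OF W] .
    then have "\<eta> = ?L (\<chi> i. c i p)" by (rule right_minus_eq[THEN iffD1])
    then show False using \<eta> by blast
  qed
  then have pos: "metric_app g Y Y p > 0"
    using g_pos[OF vector_field_tangent[OF Y U1(2)]] by (simp add: metric_app_def)
  have orth: "g q (Y q) (E j q) = 0" if q: "q \<in> ?U1" and j: "j \<in> S" for q j
  proof -
    have T: "?C q \<in> tangent_space A q" "\<And>i. i \<in> S \<Longrightarrow> E i q \<in> tangent_space A q"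
      using vector_field_tangent[OF C q] vector_field_tangent[OF E1 q] by - assumption+
    have "g q (Y q) (E j q) = g q (?C q) (E j q) - g q (\<lambda>h. \<Sum>i\<in>S. c i q * E i q h) (E j q)"
      unfolding Y_def by (rule g_diff_left[OF T(1) tangent_sum T(2)[OF j]]) (auto simp: T)
    also have "g q (\<lambda>h. \<Sum>i\<in>S. c i q * E i q h) (E j q) = (\<Sum>i\<in>S. c i q * g q (E i q) (E j q))"
      by (rule g_sum_left[OF _ _ T(2)[OF j]]) (auto simp: T)
    also have "\<dots> = (\<Sum>i\<in>S. if i = j then c i q else 0)"
      using q j on[of q _ j] by (intro sum.cong) auto
    also have "\<dots> = c j q" using j by simp
    finally show ?thesis by (simp add: c_def metric_app_def)
  qed
  \<comment> \<open>\<open>Y\<close> may vanish away from \<open>p\<close>. On this smaller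
    neighbourhood its squared length stays positive, where the power with exponent -1/2 is
    smooth.\<close>
  define U2 where "U2 = ?U1 \<inter> metric_app g Y Y -` {0<..}"
  have U2: "open U2" "p \<in> U2" "U2 \<subseteq> ?U1"
    unfolding U2_def
    using continuous_open_preimage[OF smooth_fun_continuous_on[OF U1(1) metric_app_smooth[OF Y Y]]
        U1(1)] U1(2) pos by auto
  define N where "N q = metric_app g Y Y q powr (-1/2)" for q
  have N: "smooth_fun A U2 N"
    unfolding N_def
    by (rule smooth_fun_compose[OF U2(1) smooth_fun_subset[OF metric_app_smooth[OF Y Y] U2(3)], of "{0<..}"])
      (auto simp: U2_def smooth_on_def Ck_on_powr)
  have NN: "N q * (N q * g q (Y q) (Y q)) = 1" if "q \<in> U2" for q
  proof -
    have "metric_app g Y Y q > 0" using that by (simp add: U2_def)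
    then have "N q * N q * metric_app g Y Y q = 1"
      by (simp add: N_def powr_minus_divide flip: powr_add)
    then show ?thesis by (simp add: metric_app_def mult.assoc)
  qed
  have YT: "Y q \<in> tangent_space A q" if "q \<in> U2" for q
    using vector_field_tangent[OF Y] that U2(3) by blast
  show ?thesis
  proof (rule that[of U2 "\<lambda>q h. N q * Y q h"])
    show "open U2" "p \<in> U2" "U2 \<subseteq> U" using U2 by auto
    show "vector_field_on A U2 (\<lambda>q h. N q * Y q h)"
      by (rule vector_field_mult[OF N vector_field_restrict[OF Y U2(1,3)]])
    show "\<forall>q\<in>U2. g q (\<lambda>h. N q * Y q h) (\<lambda>h. N q * Y q h) = 1 \<and>
        (\<forall>i\<in>S. g q (\<lambda>h. N q * Y q h) (E i q) = 0)"
    proof (intro ballI conjI)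
      fix q assume q: "q \<in> U2"
      show "g q (\<lambda>h. N q * Y q h) (\<lambda>h. N q * Y q h) = 1"
        using NN[OF q] YT[OF q] g_scale_left[OF YT[OF q] tangent_scale[OF YT[OF q]], of "N q" "N q"]
          g_sym[OF YT[OF q] tangent_scale[OF YT[OF q]], of "N q"]
          g_scale_left[OF YT[OF q] YT[OF q], of "N q"] by simp
      fix i assume i: "i \<in> S"
      show "g q (\<lambda>h. N q * Y q h) (E i q) = 0"
        using orth[of q i] g_scale_left[OF YT[OF q] vector_field_tangent[OF E1[OF i]]] q U2(3) i by auto
    qed
  qed
qed

text \<open>Induction over the set of indices whose fields are already constructed. Each step
  shrinks the neighbourhood of \<open>p\<close>, which happens only finitely often.\<close>

lemma orthonormal_frame_exists:
  obtains U E where "open U" "p \<in> U" "orthonormal_frame_on A g U E"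
proof -
  have "\<exists>U E. open U \<and> p \<in> U \<and> (\<forall>i\<in>S. vector_field_on A U (E i)) \<and>
      (\<forall>q\<in>U. \<forall>i\<in>S. \<forall>j\<in>S. g q (E i q) (E j q) = (if i = j then 1 else 0))"
    if "finite S" for S :: "'n set"
    using that
  proof (induction S rule: finite_induct)
    case empty
    then show ?case by (intro exI[of _ UNIV]) auto
  next
    case (insert k S)
    then obtain U E where U: "open U" "p \<in> U" and E: "\<And>i. i \<in> S \<Longrightarrow> vector_field_on A U (E i)"
      and on: "\<And>q i j. q \<in> U \<Longrightarrow> i \<in> S \<Longrightarrow> j \<in> S \<Longrightarrow>
        g q (E i q) (E j q) = (if i = j then 1 else 0)" by blast
    obtain U' X where U': "open U'" "p \<in> U'" "U' \<subseteq> U" and X: "vector_field_on A U' X"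
      "\<forall>q\<in>U'. g q (X q) (X q) = 1 \<and> (\<forall>i\<in>S. g q (X q) (E i q) = 0)"
      by (rule Gram_Schmidt_step[OF U E on insert.hyps(2)])
    have E': "vector_field_on A U' (E i)" if "i \<in> S" for i
      by (rule vector_field_restrict[OF E[OF that] U'(1,3)])
    have sym: "g q (E i q) (X q) = 0" if "q \<in> U'" "i \<in> S" for q i
      using X(2) g_sym[OF vector_field_tangent[OF X(1)] vector_field_tangent[OF E'], of q i]
        that by simp
    show ?case
      by (intro exI[of _ U'] exI[of _ "E(k := X)"])
        (use U' X E' sym on insert.hyps(2) in \<open>auto simp: subset_iff\<close>)
  qed
  from this[of UNIV] show ?thesis
    using that unfolding orthonormal_frame_on_def metric_app_def by auto
qed

lemma local_frame_orthonormal: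
  obtains U where "open U" "p \<in> U" "orthonormal_frame_on A g U (local_frame A g p)"
proof -
  have "\<exists>E U. open U \<and> p \<in> U \<and> orthonormal_frame_on A g U E"
    using orthonormal_frame_exists by metis
  from someI_ex[OF this] show ?thesis
    using that unfolding local_frame_def by blast
qed

text \<open>The \<open>THE\<close> in \<open>gradient\<close> is resolved by the combination of the
  frame fields with coefficients \<open>E i p f\<close>; two solutions differ by a vector orthogonal
  to itself. Here \<open>f\<close> may be any function, because the frame expansion is an equality
  of functionals.\<close>

lemma gradient_tangent: "gradient A g f p \<in> tangent_space A p"
  and g_gradient: "w \<in> tangent_space A p \<Longrightarrow> g p (gradient A g f p) w = w f"
proof -
  obtain U E where p: "p \<in> U" and E: "orthonormal_frame_on A g U E"
    by (rule orthonormal_frame_exists)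
  have T: "E i p \<in> tangent_space A p" for i
    using vector_field_tangent[OF orthonormal_frame_vector_field[OF E] p] .
  let ?v = "\<lambda>h. \<Sum>i\<in>UNIV. E i p f * E i p h"
  have vT: "?v \<in> tangent_space A p" by (rule tangent_sum) (simp_all add: T)
  have v: "g p ?v w = w f" if w: "w \<in> tangent_space A p" for w
  proof -
    have "g p ?v w = (\<Sum>i\<in>UNIV. g p w (E i p) * E i p f)"
      by (subst g_sum_left) (simp_all add: T w g_sym[OF T w] mult.commute)
    also have "\<dots> = w f"
      using fun_cong[OF orthonormal_frame_expansion[OF E p w], of f] by simp
    finally show ?thesis .
  qed
  have "gradient A g f p = ?v"
    unfolding gradient_def
  proof (rule the_equality)
    fix u assume u: "u \<in> tangent_space A p \<and> (\<forall>w\<in>tangent_space A p. g p u w = w f)"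
    let ?d = "\<lambda>h. u h - ?v h"
    have d: "?d \<in> tangent_space A p"
      using tangent_add[OF conjunct1[OF u] tangent_scale[OF vT, of "-1"]] by simp
    have "g p ?d ?d = 0"
      using g_diff_left[OF conjunct1[OF u] vT d] v[OF d] u d by simp
    then have "?d = (\<lambda>h. 0)" using g_pos[OF d] by fastforce
    then show "u = ?v" by (simp add: fun_eq_iff)
  qed (use v vT in blast)
  then show "gradient A g f p \<in> tangent_space A p"
    and "w \<in> tangent_space A p \<Longrightarrow> g p (gradient A g f p) w = w f"
    using v vT by simp_all
qed

lemma gradient_eq_0:
  assumes "\<And>v. v \<in> tangent_space A p \<Longrightarrow> v f = 0"
  shows "gradient A g f p = (\<lambda>h. 0)"
  using g_pos[OF gradient_tangent] g_gradient[OF gradient_tangent] assms[OF gradient_tangent]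
  by (metis less_irrefl)

lemma orthonormal_frame_restrict:
  "orthonormal_frame_on A g U E \<Longrightarrow> open U' \<Longrightarrow> U' \<subseteq> U \<Longrightarrow> orthonormal_frame_on A g U' E"
  unfolding orthonormal_frame_on_def using vector_field_restrict by blast

end

section \<open>The Levi-Civita connection\<close>

locale levi_civita_manifold = riemannian A g
  for A :: "('a::{t2_space, second_countable_topology}, 'n::finite) atlas"
    and g :: "'a metric" +
  fixes D :: "'a connection"
  assumes connection: "levi_civita A g D"
begin

lemma
  assumes "vector_field_on A U X" "vector_field_on A U Y"
  shows D_vector_field: "vector_field_on A U (D X Y)"
    and D_add_left: "vector_field_on A U Z \<Longrightarrow> p \<in> U \<Longrightarrow>
      D (\<lambda>q h. X q h + Z q h) Y p = (\<lambda>h. D X Y p h + D Z Y p h)"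
    and D_mult_left: "smooth_fun A U f \<Longrightarrow> p \<in> U \<Longrightarrow>
      D (\<lambda>q h. f q * X q h) Y p = (\<lambda>h. f p * D X Y p h)"
    and D_torsion_free: "p \<in> U \<Longrightarrow> (\<lambda>h. D X Y p h - D Y X p h) = lie_bracket A X Y p"
    and D_metric: "vector_field_on A U Z \<Longrightarrow> p \<in> U \<Longrightarrow>
      X p (metric_app g Y Z) = metric_app g (D X Y) Z p + metric_app g Y (D X Z) p"
  using connection assms smooth_fun_const[of U 0] unfolding levi_civita_def by blast+

text \<open>\<open>D\<close> takes fields on the whole type, and \<open>levi_civita\<close> does not
  state that its values on \<open>U\<close> ignore the arguments off \<open>U\<close>. For the first
  slot this follows from linearity over functions.\<close>

lemma D_cong_left:
  assumes X: "vector_field_on A U X" and Y: "vector_field_on A U Y"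
    and eq: "\<And>q. q \<in> U \<Longrightarrow> X q = X' q" and p: "p \<in> U"
  shows "D X Y p = D X' Y p"
proof -
  have U: "open U" using vector_field_open[OF X] .
  define Z where "Z = (\<lambda>q h. X' q h - X q h)"
  define f :: "'a \<Rightarrow> real" where "f q = (if q \<in> U then 0 else 1)" for q
  have Z: "vector_field_on A U Z"
    unfolding Z_def by (rule vector_field_diff[OF vector_field_cong[OF X eq] X])
  have f: "smooth_fun A U f"
    by (rule smooth_fun_cong[OF U _ smooth_fun_const[of U 0]]) (simp add: f_def)
  \<comment> \<open>\<open>f\<close> is 1 off \<open>U\<close>, where \<open>Z\<close> is unknown, so \<open>f Z = Z\<close> holds globally\<close>
  have "(\<lambda>q h. f q * Z q h) = Z"
    using eq by (auto simp: f_def Z_def fun_eq_iff)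
  then have "D Z Y p = (\<lambda>h. 0)"
    using D_mult_left[OF Z Y f p] p by (simp add: f_def)
  moreover have "(\<lambda>q h. X q h + Z q h) = X'" by (simp add: Z_def)
  ultimately show ?thesis
    using D_add_left[OF X Y Z p] by simp
qed

lemma D_sum_left:
  assumes "open U" "finite I" "\<And>i. i \<in> I \<Longrightarrow> smooth_fun A U (f i)"
    "\<And>i. i \<in> I \<Longrightarrow> vector_field_on A U (X i)" "vector_field_on A U Y" "p \<in> U"
  shows "D (\<lambda>q h. \<Sum>i\<in>I. f i q * X i q h) Y p = (\<lambda>h. \<Sum>i\<in>I. f i p * D (X i) Y p h)"
  using assms(2-4)
proof (induction I rule: finite_induct)
  case empty
  show ?case
    using D_mult_left[OF vector_field_zero[OF assms(1)] assms(5) smooth_fun_const[of U 0] assms(6)]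
    by simp
next
  case (insert i I)
  have "vector_field_on A U (\<lambda>q h. f i q * X i q h)"
    "vector_field_on A U (\<lambda>q h. \<Sum>i\<in>I. f i q * X i q h)"
    using insert.prems insert.hyps by (auto intro!: vector_field_mult vector_field_sum assms(1))
  from D_add_left[OF this(1) assms(5) this(2) assms(6)] show ?case
    using insert D_mult_left[OF _ assms(5) _ assms(6), of "X i" "f i"] by simp
qed

text \<open>Torsion-freeness identifies the bracket with \<open>D X Y - D Y X\<close>, so tangency
  and smoothness come from those of \<open>D\<close>, without second derivatives in charts.\<close>

lemma lie_bracket_vector_field:
  assumes "vector_field_on A U X" "vector_field_on A U Y"
  shows "vector_field_on A U (lie_bracket A X Y)"
  by (rule vector_field_cong[OF vector_field_diff[OF D_vector_field[OF assms]
          D_vector_field[OF assms(2,1)]]])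
    (rule D_torsion_free[OF assms])

lemma lie_bracket_apply:
  assumes "open U" "p \<in> U" "smooth_fun A U h"
  shows "lie_bracket A X Y p h = X p (\<lambda>q. Y q h) - Y p (\<lambda>q. X q h)"
  using smooth_atI[OF assms] by (simp add: lie_bracket_def)

lemma metric_app_sym:
  "vector_field_on A U X \<Longrightarrow> vector_field_on A U Y \<Longrightarrow> p \<in> U
    \<Longrightarrow> metric_app g X Y p = metric_app g Y X p"
  unfolding metric_app_def by (intro g_sym vector_field_tangent)

lemma D_expand_left:
  assumes E: "orthonormal_frame_on A g U E" and X: "vector_field_on A U X"
    and Y: "vector_field_on A U Y" and p: "p \<in> U"
  shows "D X Y p = (\<lambda>h. \<Sum>i\<in>UNIV. g p (X p) (E i p) * D (E i) Y p h)"
proof -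
  have U: "open U" using vector_field_open[OF X] .
  have Ei: "vector_field_on A U (E i)" for i by (rule orthonormal_frame_vector_field[OF E])
  have "D X Y p = D (\<lambda>q h. \<Sum>i\<in>UNIV. metric_app g X (E i) q * E i q h) Y p"
    by (rule D_cong_left[OF X Y _ p])
      (unfold metric_app_def, rule orthonormal_frame_expansion[OF E _ vector_field_tangent[OF X]])
  also have "\<dots> = (\<lambda>h. \<Sum>i\<in>UNIV. metric_app g X (E i) p * D (E i) Y p h)"
    by (rule D_sum_left[OF U finite metric_app_smooth[OF X Ei] Ei Y p])
  finally show ?thesis by (simp add: metric_app_def)
qed

text \<open>Expand \<open>E i\<close> in the frame \<open>F\<close>, swap the sums, and let
  \<open>parseval\<close> for \<open>E\<close> collapse the inner one.\<close>

lemma trace_frame_independent: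
  assumes E: "orthonormal_frame_on A g U E" and F: "orthonormal_frame_on A g U F"
    and V: "vector_field_on A U V" and p: "p \<in> U"
  shows "(\<Sum>i\<in>UNIV. g p (D (E i) V p) (E i p)) = (\<Sum>i\<in>UNIV. g p (D (F i) V p) (F i p))"
proof -
  have Ei: "vector_field_on A U (E i)" and Fi: "vector_field_on A U (F i)" for i
    using E F orthonormal_frame_vector_field by blast+
  have ET: "E i p \<in> tangent_space A p" and FT: "F i p \<in> tangent_space A p"
    and DT: "D (F i) V p \<in> tangent_space A p" for i
    using vector_field_tangent p Ei Fi D_vector_field[OF Fi V] by blast+
  have "(\<Sum>i\<in>UNIV. g p (D (E i) V p) (E i p))
      = (\<Sum>i\<in>UNIV. \<Sum>j\<in>UNIV. g p (E i p) (F j p) * g p (D (F j) V p) (E i p))"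
    by (subst D_expand_left[OF F Ei V p], subst g_sum_left) (simp_all add: DT ET)
  also have "\<dots> = (\<Sum>j\<in>UNIV. \<Sum>i\<in>UNIV. g p (F j p) (E i p) * g p (D (F j) V p) (E i p))"
    by (subst sum.swap) (simp add: g_sym[OF ET FT])
  also have "\<dots> = (\<Sum>j\<in>UNIV. g p (F j p) (D (F j) V p))"
    by (simp add: parseval[OF E p FT DT])
  finally show ?thesis by (simp add: g_sym[OF FT DT])
qed

text \<open>Metric compatibility expands the derivative along \<open>V\<close>, torsion-freeness
  expands the brackets, and the terms with \<open>\<nabla>\<^sub>V\<close> cancel.\<close>

lemma lie_metric_eq:
  assumes V: "vector_field_on A U V" and X: "vector_field_on A U X" and Y: "vector_field_on A U Y"
    and p: "p \<in> U"
  shows "lie_metric A g V X Y p = g p (D X V p) (Y p) + g p (X p) (D Y V p)"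
proof -
  note T = vector_field_tangent[OF _ p]
  have "lie_metric A g V X Y p = g p (D V X p) (Y p) + g p (X p) (D V Y p)
      - g p (\<lambda>h. D V X p h - D X V p h) (Y p) - g p (X p) (\<lambda>h. D V Y p h - D Y V p h)"
    using D_metric[OF V X Y p] D_torsion_free[OF V X p] D_torsion_free[OF V Y p]
    by (simp add: lie_metric_def metric_app_def)
  moreover have "g p (\<lambda>h. D V X p h - D X V p h) (Y p) = g p (D V X p) (Y p) - g p (D X V p) (Y p)"
    by (intro g_diff_left T D_vector_field V X Y)
  moreover have "g p (X p) (\<lambda>h. D V Y p h - D Y V p h) = g p (X p) (D V Y p) - g p (X p) (D Y V p)"
    using g_diff_left[OF T[OF D_vector_field[OF V Y]] T[OF D_vector_field[OF Y V]] T[OF X]]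
      g_sym[OF T[OF X]] T[OF vector_field_diff[OF D_vector_field[OF V Y] D_vector_field[OF Y V]]]
      T[OF D_vector_field[OF V Y]] T[OF D_vector_field[OF Y V]] by simp
  ultimately show ?thesis by simp
qed

text \<open>The bracket acts on the function \<open>g(Z, W)\<close> in two ways: as a commutator,
  and through metric compatibility.\<close>

lemma lie_bracket_metric:
  assumes X: "vector_field_on A U X" and Y: "vector_field_on A U Y" and Z: "vector_field_on A U Z"
    and W: "vector_field_on A U W" and p: "p \<in> U"
  shows "X p (\<lambda>q. Y q (metric_app g Z W)) - Y p (\<lambda>q. X q (metric_app g Z W))
    = metric_app g (D (lie_bracket A X Y) Z) W p + metric_app g Z (D (lie_bracket A X Y) W) p"
  using lie_bracket_apply[OF vector_field_open[OF X] p metric_app_smooth[OF Z W], of X Y]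
    D_metric[OF lie_bracket_vector_field[OF X Y] Z W p] by simp

text \<open>This is the Lie derivative along \<open>V\<close> of \<open>\<nabla>g = 0\<close>.
  Explicitly, the terms with a bracket with \<open>V\<close> in one slot and a derivative along
  \<open>X\<close> in the other cancel. The remaining second derivatives of \<open>g(Y, Z)\<close>
  form a commutator, which \<open>lie_bracket_metric\<close> evaluates.\<close>

lemma cov_lie_metric:
  assumes V: "vector_field_on A U V" and X: "vector_field_on A U X"
    and Y: "vector_field_on A U Y" and Z: "vector_field_on A U Z" and p: "p \<in> U"
  shows "cov_tensor2 D X (lie_metric A g V) Y Z p
    = g p (lie_connection A D V X Y p) (Z p) + g p (Y p) (lie_connection A D V X Z p)"
proof -
  let ?m = "metric_app g" and ?b = "lie_bracket A V"
  note U = vector_field_open[OF X]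
  note T = vector_field_tangent[OF _ p]
  note F = D_vector_field lie_bracket_vector_field V X Y Z
  have XT: "X p \<in> tangent_space A p" and VT: "V p \<in> tangent_space A p" using T X V by auto
  have sm: "smooth_at A p (?m S S')" if "vector_field_on A U S" "vector_field_on A U S'" for S S'
    by (rule smooth_atI[OF U p metric_app_smooth[OF that]])
  have sV: "smooth_at A p (\<lambda>q. V q (?m Y Z))"
    by (rule smooth_atI[OF U p vector_field_smooth[OF V U order_refl metric_app_smooth[OF Y Z]]])
  have 1: "X p (lie_metric A g V Y Z) = X p (\<lambda>q. V q (?m Y Z)) - X p (?m (?b Y) Z) - X p (?m Y (?b Z))"
  proof -
    have "smooth_at A p (\<lambda>q. V q (?m Y Z) - ?m (?b Y) Z q)"
      using smooth_fun_add[OF U vector_field_smooth[OF V U order_refl metric_app_smooth[OF Y Z]]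
          smooth_fun_mult[OF U smooth_fun_const[of U "-1"] metric_app_smooth[OF F(2)[OF V Y] Z]]]
      by (intro smooth_atI[OF U p]) simp
    then show ?thesis
      unfolding lie_metric_def
      using tangent_fun_diff[OF XT sV sm[OF F(2)[OF V Y] Z]]
        tangent_fun_diff[OF XT _ sm[OF Y F(2)[OF V Z]], of "\<lambda>q. V q (?m Y Z) - ?m (?b Y) Z q"]
      by simp
  qed
  have 2: "V p (\<lambda>q. X q (?m Y Z)) = V p (?m (D X Y) Z) + V p (?m Y (D X Z))"
  proof -
    have "V p (\<lambda>q. X q (?m Y Z)) = V p (\<lambda>q. ?m (D X Y) Z q + ?m Y (D X Z) q)"
      by (rule tangent_cong[OF VT U p]) (rule D_metric[OF X Y Z])
    also have "\<dots> = V p (?m (D X Y) Z) + V p (?m Y (D X Z))"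
      by (rule tangent_fun_add[OF VT sm[OF F(1)[OF X Y] Z] sm[OF Y F(1)[OF X Z]]])
    finally show ?thesis .
  qed
  have 3: "X p (?m (?b Y) Z) = ?m (D X (?b Y)) Z p + ?m (?b Y) (D X Z) p"
    "X p (?m Y (?b Z)) = ?m (D X Y) (?b Z) p + ?m Y (D X (?b Z)) p"
    by (rule D_metric[OF X _ _ p]; intro F)+
  have 4: "V p (\<lambda>q. X q (?m Y Z)) - X p (\<lambda>q. V q (?m Y Z)) = ?m (D (?b X) Y) Z p + ?m Y (D (?b X) Z) p"
    by (rule lie_bracket_metric[OF V X Y Z p])
  have lc: "g p (lie_connection A D V X S p) (S' p)
      = ?m (?b (D X S)) S' p - ?m (D (?b X) S) S' p - ?m (D X (?b S)) S' p"
    "lie_connection A D V X S p \<in> tangent_space A p"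
    if S: "vector_field_on A U S" and S': "vector_field_on A U S'" for S S'
  proof -
    note B = F(2)[OF V F(1)[OF X S]] F(1)[OF F(2)[OF V X] S] F(1)[OF X F(2)[OF V S]]
    show "g p (lie_connection A D V X S p) (S' p)
      = ?m (?b (D X S)) S' p - ?m (D (?b X) S) S' p - ?m (D X (?b S)) S' p"
      unfolding lie_connection_def metric_app_def
      using g_diff_left[OF T[OF vector_field_diff[OF B(1,2)]] T[OF B(3)] T[OF S']]
        g_diff_left[OF T[OF B(1)] T[OF B(2)] T[OF S']] by simp
    show "lie_connection A D V X S p \<in> tangent_space A p"
      unfolding lie_connection_def
      using T[OF vector_field_diff[OF vector_field_diff[OF B(1,2)] B(3)]] .
  qed
  have "g p (Y p) (lie_connection A D V X Z p)
      = ?m Y (?b (D X Z)) p - ?m Y (D (?b X) Z) p - ?m Y (D X (?b Z)) p"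
    using lc(1)[OF Z Y] g_sym[OF T[OF Y] lc(2)[OF Z Y]]
      metric_app_sym[OF Y F(2)[OF V F(1)[OF X Z]] p] metric_app_sym[OF Y F(1)[OF F(2)[OF V X] Z] p]
      metric_app_sym[OF Y F(1)[OF X F(2)[OF V Z]] p] by simp
  then show ?thesis
    unfolding cov_tensor2_def using 1 2 3 4 lc(1)[OF Y Z]
    by (simp add: lie_metric_def)
qed


section \<open>Harmonic fields and affine conformal fields\<close>

lemma lie_metric_smooth:
  assumes V: "vector_field_on A U V" and X: "vector_field_on A U X" and Y: "vector_field_on A U Y"
  shows "smooth_fun A U (lie_metric A g V X Y)"
  using vector_field_open[OF V]
proof (rule smooth_fun_cong)
  show "smooth_fun A U (\<lambda>q. metric_app g (D X V) Y q + metric_app g X (D Y V) q)"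
    by (intro smooth_fun_add metric_app_smooth D_vector_field V X Y vector_field_open[OF V])
qed (simp add: metric_app_def lie_metric_eq[OF V X Y])

text \<open>Metric compatibility writes \<open>X (\<omega> Y)\<close> as
  \<open>g(\<nabla>\<^sub>X Y, V) + g(\<nabla>\<^sub>X V, Y)\<close>. In
  \<open>d\<omega>(X, Y)\<close> the terms of the first kind cancel against
  \<open>\<omega> [X, Y]\<close> by torsion-freeness, and those of the second kind remain.\<close>

lemma closed_form_symmetric:
  assumes \<omega>: "associated_form A g V \<omega>" and closed: "exterior_derivative1 A \<omega> X Y p = 0"
    and V: "vector_field_on A U V" and X: "vector_field_on A U X" and Y: "vector_field_on A U Y"
    and p: "p \<in> U"
  shows "g p (D X V p) (Y p) = g p (D Y V p) (X p)"
proof -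
  note T = vector_field_tangent[OF _ p]
  have app: "\<omega> q (Z q) = metric_app g Z V q" if "vector_field_on A U Z" "q \<in> U" for Z q
    using \<omega> vector_field_tangent[OF that] unfolding associated_form_def metric_app_def by blast
  have d: "Z p (\<lambda>q. \<omega> q (S q)) = g p (D Z S p) (V p) + g p (D Z V p) (S p)"
    if Z: "vector_field_on A U Z" and S: "vector_field_on A U S" for Z S
  proof -
    have "Z p (\<lambda>q. \<omega> q (S q)) = Z p (metric_app g S V)"
      by (rule tangent_cong[OF T[OF Z] vector_field_open[OF V] p]) (rule app[OF S])
    then show ?thesis
      using D_metric[OF Z S V p] g_sym[OF T[OF S] T[OF D_vector_field[OF Z V]]]
      by (simp add: metric_app_def)
  qed
  have "\<omega> p (lie_bracket A X Y p) = g p (D X Y p) (V p) - g p (D Y X p) (V p)"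
    using app[OF lie_bracket_vector_field[OF X Y] p] D_torsion_free[OF X Y p, symmetric]
      g_diff_left[OF T[OF D_vector_field[OF X Y]] T[OF D_vector_field[OF Y X]] T[OF V]]
    by (simp add: metric_app_def)
  then show ?thesis
    using closed d[OF X Y] d[OF Y X] unfolding exterior_derivative1_def by simp
qed

text \<open>For the frame chosen at \<open>p\<close>, metric compatibility turns each derivative of
  \<open>\<omega>\<close> into one of \<open>V\<close>. Since \<open>E\<close> is arbitrary, the
  trace vanishes over one fixed frame at every point of its domain.\<close>

lemma coclosed_form_trace:
  assumes \<omega>: "associated_form A g V \<omega>" and coclosed: "codifferential1 A g D \<omega> p = 0"
    and V: "vector_field_on A U V" and E: "orthonormal_frame_on A g U E" and p: "p \<in> U"
  shows "(\<Sum>i\<in>UNIV. g p (D (E i) V p) (E i p)) = 0"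
proof -
  let ?F = "local_frame A g p"
  obtain U0 where U0: "open U0" "p \<in> U0" "orthonormal_frame_on A g U0 ?F"
    by (rule local_frame_orthonormal)
  define U' where "U' = U \<inter> U0"
  have U': "open U'" "p \<in> U'" "U' \<subseteq> U" "U' \<subseteq> U0"
    using U0 p vector_field_open[OF V] by (auto simp: U'_def)
  have V': "vector_field_on A U' V" by (rule vector_field_restrict[OF V U'(1,3)])
  have E': "orthonormal_frame_on A g U' E" by (rule orthonormal_frame_restrict[OF E U'(1,3)])
  have F': "orthonormal_frame_on A g U' ?F" by (rule orthonormal_frame_restrict[OF U0(3) U'(1,4)])
  note Fi = orthonormal_frame_vector_field[OF F']
  note T = vector_field_tangent[OF _ U'(2)]
  have app: "\<omega> q (Z q) = metric_app g Z V q" if "vector_field_on A U' Z" "q \<in> U'" for Z q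
    using \<omega> vector_field_tangent[OF that] unfolding associated_form_def metric_app_def by blast
  have "cov_form1 D (?F i) \<omega> (?F i) p = g p (D (?F i) V p) (?F i p)" for i
  proof -
    have "?F i p (\<lambda>q. \<omega> q (?F i q)) = ?F i p (metric_app g (?F i) V)"
      by (rule tangent_cong[OF T[OF Fi] U'(1,2)]) (rule app[OF Fi])
    then show ?thesis
      using D_metric[OF Fi Fi V' U'(2)] app[OF D_vector_field[OF Fi Fi] U'(2)]
        g_sym[OF T[OF Fi] T[OF D_vector_field[OF Fi V']]]
      by (simp add: cov_form1_def metric_app_def)
  qed
  then have "(\<Sum>i\<in>UNIV. g p (D (?F i) V p) (?F i p)) = 0"
    using coclosed by (simp add: codifferential1_def Let_def)
  then show ?thesis
    using trace_frame_independent[OF E' F' V' U'(2)] by simp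
qed

text \<open>Pairing the gradient with \<open>Z\<close> gives \<open>Z f\<close>, so besides
  \<open>(X f) g(Y, Z)\<close> the two slots contribute \<open>(Y f) g(X, Z) - g(X, Y) (Z f)\<close>
  and \<open>(Z f) g(X, Y) - g(X, Z) (Y f)\<close>, which cancel.\<close>

lemma affine_conformal_cov_lie_metric:
  assumes V: "vector_field_on A U V" and X: "vector_field_on A U X"
    and Y: "vector_field_on A U Y" and Z: "vector_field_on A U Z" and p: "p \<in> U"
    and conf: "\<And>X Y. vector_field_on A U X \<Longrightarrow> vector_field_on A U Y \<Longrightarrow> lie_connection A D V X Y p
      = (\<lambda>h. X p f * Y p h + Y p f * X p h - metric_app g X Y p * gradient A g f p h)"
  shows "cov_tensor2 D X (lie_metric A g V) Y Z p = 2 * X p f * metric_app g Y Z p"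
proof -
  note T = vector_field_tangent[OF _ p]
  have lc: "g p (lie_connection A D V X S p) (S' p)
      = X p f * g p (S p) (S' p) + S p f * g p (X p) (S' p) - g p (X p) (S p) * S' p f"
    if S: "vector_field_on A U S" and S': "vector_field_on A U S'" for S S'
    using g_diff_left[OF tangent_add[OF tangent_scale[OF T[OF S]] tangent_scale[OF T[OF X]]]
        tangent_scale[OF gradient_tangent] T[OF S'], of "X p f" "S p f" "g p (X p) (S p)" f]
      g_add_left[OF tangent_scale[OF T[OF S]] tangent_scale[OF T[OF X]] T[OF S'], of "X p f" "S p f"]
    by (simp add: conf[OF X S] metric_app_def T X S S' g_scale_left gradient_tangent g_gradient)
  have "lie_connection A D V X Z p \<in> tangent_space A p"
    unfolding lie_connection_def
    by (intro T[of "\<lambda>q h. _ q h - _ q h - _ q h"] vector_field_diff D_vector_field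
        lie_bracket_vector_field V X Z)
  then have "g p (Y p) (lie_connection A D V X Z p) = g p (lie_connection A D V X Z p) (Y p)"
    using g_sym T[OF Y] by blast
  then show ?thesis
    using cov_lie_metric[OF V X Y Z p] lc[OF Y Z] lc[OF Z Y] g_sym[OF T[OF Y] T[OF Z]]
    by (simp add: metric_app_def algebra_simps)
qed

text \<open>Summing \<open>cov\<close> over the frame gives \<open>2 n (X f)\<close> on the right.
  On the left it gives the derivative of the trace and a correction from the derivatives of the
  frame, and both are 0. The trace is differentiated along \<open>X\<close>, so \<open>tr\<close>
  must hold on all of \<open>U\<close>, while \<open>sym\<close> is a condition at
  \<open>p\<close>.\<close>

lemma harmonic_affine_conformal_factor:
  assumes V: "vector_field_on A U V" and X: "vector_field_on A U X" and p: "p \<in> U"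
    and E: "orthonormal_frame_on A g U E"
    and sym: "\<And>X Y. vector_field_on A U X \<Longrightarrow> vector_field_on A U Y
      \<Longrightarrow> g p (D X V p) (Y p) = g p (D Y V p) (X p)"
    and tr: "\<And>q. q \<in> U \<Longrightarrow> (\<Sum>i\<in>UNIV. g q (D (E i) V q) (E i q)) = 0"
    and cov: "\<And>Y. vector_field_on A U Y \<Longrightarrow>
      cov_tensor2 D X (lie_metric A g V) Y Y p = 2 * X p f * metric_app g Y Y p"
  shows "X p f = 0"
proof -
  let ?L = "lie_metric A g V"
  have U: "open U" by (rule vector_field_open[OF V])
  note Ei = orthonormal_frame_vector_field[OF E]
  note T = vector_field_tangent
  have L: "?L Y Y q = 2 * g q (D Y V q) (Y q)" if "q \<in> U" "vector_field_on A U Y" for q Y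
    using lie_metric_eq[OF V that(2,2,1)]
      g_sym[OF T[OF that(2,1)] T[OF D_vector_field[OF that(2) V] that(1)]] by simp
  have "(\<Sum>i\<in>UNIV. X p (?L (E i) (E i))) = X p (\<lambda>q. \<Sum>i\<in>UNIV. ?L (E i) (E i) q)"
    by (rule conjunct1[OF tangent_fun_sum[OF T[OF X p] finite U p lie_metric_smooth[OF V Ei Ei]],
          symmetric])
  also have "\<dots> = X p (\<lambda>q. 0)"
    by (rule tangent_cong[OF T[OF X p] U p]) (simp add: L Ei tr flip: sum_distrib_left)
  also have "\<dots> = 0" by (rule tangent_fun_const[OF T[OF X p]])
  finally have 1: "(\<Sum>i\<in>UNIV. X p (?L (E i) (E i))) = 0" .
  \<comment> \<open>\<open>?a\<close> holds the connection coefficients of the frame along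
    \<open>X\<close>, which are skew because orthonormality is differentiated; \<open>?b\<close> is
    the symmetric matrix of \<open>h\<close>.\<close>
  let ?a = "\<lambda>i j. g p (D X (E i) p) (E j p)" and ?b = "\<lambda>i j. g p (D (E j) V p) (E i p)"
  have a: "?a i j = - ?a j i" for i j
  proof -
    have "X p (metric_app g (E i) (E j)) = X p (\<lambda>q. if i = j then 1 else 0)"
      by (rule tangent_cong[OF T[OF X p] U p])
        (simp add: metric_app_def orthonormal_frame_metric[OF E])
    then show ?thesis
      using D_metric[OF X Ei Ei p, of i j] tangent_fun_const[OF T[OF X p]]
        g_sym[OF T[OF Ei p] T[OF D_vector_field[OF X Ei] p], of i j]
      by (simp add: metric_app_def)
  qed
  have b: "?b i j = ?b j i" for i j by (rule sym[OF Ei Ei])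
  have "(\<Sum>i\<in>UNIV. g p (D (D X (E i)) V p) (E i p)) = (\<Sum>i\<in>UNIV. \<Sum>j\<in>UNIV. ?a i j * ?b i j)"
    by (subst D_expand_left[OF E D_vector_field[OF X Ei] V p], subst g_sum_left)
      (simp_all add: T[OF D_vector_field[OF Ei V] p] T[OF Ei p])
  moreover have "(\<Sum>i\<in>UNIV. \<Sum>j\<in>UNIV. ?a i j * ?b i j) = - (\<Sum>i\<in>UNIV. \<Sum>j\<in>UNIV. ?a i j * ?b i j)"
  proof -
    have "?a i j * ?b i j = - (?a j i * ?b j i)" for i j
      by (simp only: a[of i j] b[of i j] mult_minus_left)
    then have "(\<Sum>i\<in>UNIV. \<Sum>j\<in>UNIV. ?a i j * ?b i j)
        = (\<Sum>i\<in>UNIV. \<Sum>j\<in>UNIV. - (?a j i * ?b j i))" by (intro sum.cong refl)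
    also have "\<dots> = - (\<Sum>i\<in>UNIV. \<Sum>j\<in>UNIV. ?a i j * ?b i j)"
      by (subst sum.swap) (simp add: sum_negf)
    finally show ?thesis .
  qed
  ultimately have 2: "(\<Sum>i\<in>UNIV. g p (D (D X (E i)) V p) (E i p)) = 0" by linarith
  \<comment> \<open>With \<open>S = \<nabla>\<^sub>X E\<^sub>i\<close>, each of the two slots of
    \<open>?L\<close> contributes \<open>2 g(\<nabla>\<^sub>S V, E\<^sub>i)\<close>, hence the
    factor 4.\<close>
  have "X p (?L (E i) (E i)) = 2 * X p f + 4 * g p (D (D X (E i)) V p) (E i p)" for i
  proof -
    note DX = D_vector_field[OF X Ei[of i]]
    have "?L (D X (E i)) (E i) p = 2 * g p (D (D X (E i)) V p) (E i p)"
      "?L (E i) (D X (E i)) p = 2 * g p (D (D X (E i)) V p) (E i p)"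
      using lie_metric_eq[OF V DX Ei p, of i] lie_metric_eq[OF V Ei DX p, of i] sym[OF DX Ei, of i]
        g_sym[OF T[OF DX p] T[OF D_vector_field[OF Ei V] p], of i]
        g_sym[OF T[OF Ei p] T[OF D_vector_field[OF DX V] p], of i] by simp_all
    then show ?thesis
      using cov[OF Ei, of i] orthonormal_frame_metric[OF E p, of i i]
      by (simp add: cov_tensor2_def metric_app_def)
  qed
  then have "(\<Sum>i\<in>(UNIV :: 'n set). 2 * X p f) = 0"
    using 1 2 by (simp add: sum.distrib flip: sum_distrib_left)
  then show ?thesis by simp
qed

end

theorem corollary3p4:
  fixes A :: "('a::{t2_space, second_countable_topology}, 'n::finite) atlas"
    and g :: "'a metric" and D :: "'a connection"
    and V :: "'a field" and \<omega> :: "'a form1"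
    and lam :: "'a \<Rightarrow> real" and \<beta> :: real
  assumes "CARD('n) \<ge> 4"
    and "riemannian_manifold A g"
    and "compact (UNIV :: 'a set)"
    and "levi_civita A g D"
    and "almost_omega_bach_soliton A g D \<omega> V lam \<beta>"
    and "\<And>p. ricci_tensor A g D V V p \<ge> 0"
    and "affine_conformal_field A g D V"
    and "associated_form A g V \<omega>"
    and "harmonic_form1 A g D \<omega>"
    and "divergence_free A g D (omega_bach_tensor A g D \<omega> \<beta>)"
  shows "omega_bach_soliton A g D \<omega> V lam \<beta> \<and> affine_field A D V"
proof -
  interpret levi_civita_manifold A g D
    using assms(2,4) by unfold_locales (auto simp: riemannian_manifold_def)
  let ?L = "lie_metric A g V" and ?T = "omega_bach_tensor A g D \<omega> \<beta>" and ?m = "metric_app g"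
  have V: "vector_field_on A UNIV V"
    using assms(7) unfolding affine_conformal_field_def by blast
  have VU: "vector_field_on A U V" if "open U" for U
    by (rule vector_field_restrict[OF V that]) simp
  obtain f where conf: "lie_connection A D V X Y p = (\<lambda>h.
      X p f * Y p h + Y p f * X p h - metric_app g X Y p * gradient A g f p h)"
    if "vector_field_on A U X" "vector_field_on A U Y" "p \<in> U" for U X Y p
    using assms(7) unfolding affine_conformal_field_def by blast
  have closed: "exterior_derivative1 A \<omega> X Y p = 0"
    if "vector_field_on A U X" "vector_field_on A U Y" "p \<in> U" for U X Y p
    using assms(9) that unfolding harmonic_form1_def by blast
  have coclosed: "codifferential1 A g D \<omega> p = 0" for p
    using assms(9) unfolding harmonic_form1_def by blast
  have cov: "cov_tensor2 D X ?L Y Z p = 2 * X p f * ?m Y Z p"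
    if "vector_field_on A U X" "vector_field_on A U Y" "vector_field_on A U Z" "p \<in> U" for U X Y Z p
    by (rule affine_conformal_cov_lie_metric[OF VU[OF vector_field_open[OF that(1)]] that(1-4)])
      (rule conf[OF _ _ that(4)])
  have f0: "v f = 0" if v: "v \<in> tangent_space A p" for v p
  proof -
    obtain U1 X where U1: "p \<in> U1" "vector_field_on A U1 X" "X p = v"
      using tangent_extension[OF v] .
    obtain U2 E where U2: "open U2" "p \<in> U2" "orthonormal_frame_on A g U2 E"
      by (rule orthonormal_frame_exists)
    define U where "U = U1 \<inter> U2"
    have U: "open U" "p \<in> U" "U \<subseteq> U1" "U \<subseteq> U2"
      using U1 U2 vector_field_open by (auto simp: U_def)
    have X: "vector_field_on A U X" by (rule vector_field_restrict[OF U1(2) U(1,3)])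
    have E: "orthonormal_frame_on A g U E" by (rule orthonormal_frame_restrict[OF U2(3) U(1,4)])
    have "X p f = 0"
    proof (rule harmonic_affine_conformal_factor[OF VU[OF U(1)] X U(2) E])
      show "g p (D X V p) (Y p) = g p (D Y V p) (X p)"
        if "vector_field_on A U X" "vector_field_on A U Y" for X Y
        by (rule closed_form_symmetric[OF assms(8) closed[OF that U(2)] VU[OF U(1)] that U(2)])
      show "(\<Sum>i\<in>UNIV. g q (D (E i) V q) (E i q)) = 0" if "q \<in> U" for q
        by (rule coclosed_form_trace[OF assms(8) coclosed VU[OF U(1)] E that])
      show "cov_tensor2 D X ?L Y Y p = 2 * X p f * ?m Y Y p" if "vector_field_on A U Y" for Y
        by (rule cov[OF X that that U(2)])
    qed
    then show ?thesis using U1(3) by simp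
  qed
  \<comment> \<open>The affine conformal equation contains \<open>f\<close> only through
    \<open>X f\<close>, \<open>Y f\<close> and the gradient, so \<open>V\<close> is affine as soon
    as the differential of \<open>f\<close> vanishes.\<close>
  have grad0: "gradient A g f p = (\<lambda>h. 0)" for p
    by (rule gradient_eq_0) (rule f0)
  have "lie_connection A D V X Y p = (\<lambda>h. 0)"
    if "vector_field_on A U X" "vector_field_on A U Y" "p \<in> U" for U X Y p
    using conf[OF that] grad0 f0[OF vector_field_tangent[OF that(1,3)]]
      f0[OF vector_field_tangent[OF that(2,3)]] by simp
  then have affine: "affine_field A D V"
    using V unfolding affine_field_def by blast
  have sol: "1 / 2 * ?L X Y p + ?T X Y p = lam p * ?m X Y p"
      if "vector_field_on A U X" "vector_field_on A U Y" "p \<in> U" for U X Y p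
    using assms(5) that unfolding almost_omega_bach_soliton_def by blast+
  have lam: "smooth_fun A UNIV lam"
    using assms(5) unfolding almost_omega_bach_soliton_def by blast
  have covT: "cov_tensor2 D X ?T Y Z p = X p lam * ?m Y Z p"
    if X: "vector_field_on A U X" and Y: "vector_field_on A U Y" and Z: "vector_field_on A U Z"
      and p: "p \<in> U" for U X Y Z p
  proof -
    have U: "open U" by (rule vector_field_open[OF X])
    have XT: "X p \<in> tangent_space A p" by (rule vector_field_tangent[OF X p])
    have T: "?T S S' q = lam q * ?m S S' q + (- 1 / 2) * ?L S S' q"
      if "vector_field_on A U S" "vector_field_on A U S'" "q \<in> U" for S S' q
      using sol[OF that] by simp
    have l: "smooth_at A p lam" by (rule smooth_atI[OF open_UNIV UNIV_I lam])
    have m: "smooth_at A p (?m Y Z)" by (rule smooth_atI[OF U p metric_app_smooth[OF Y Z]])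
    have L: "smooth_fun A U (?L Y Z)" by (rule lie_metric_smooth[OF VU[OF U] Y Z])
    have c: "smooth_fun A U (\<lambda>q. - 1 / 2)" by (rule smooth_fun_const)
    \<comment> \<open>Locality lets the soliton equation replace \<open>?T\<close> under the
      derivative, so the smoothness of \<open>?T\<close> need not be extracted from the definition
      of the Bach tensor.\<close>
    have "X p (?T Y Z) = X p (\<lambda>q. lam q * ?m Y Z q + (- 1 / 2) * ?L Y Z q)"
      by (rule tangent_cong[OF XT U p]) (rule T[OF Y Z])
    also have "\<dots> = X p (\<lambda>q. lam q * ?m Y Z q) + X p (\<lambda>q. (- 1 / 2) * ?L Y Z q)"
      by (intro tangent_fun_add[OF XT] smooth_atI[OF U p] smooth_fun_mult metric_app_smooth
          U Y Z L c smooth_fun_subset[OF lam]) simp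
    also have "\<dots> = lam p * X p (?m Y Z) + X p lam * ?m Y Z p - 1 / 2 * X p (?L Y Z)"
      using tangent_fun_mult[OF XT l m] tangent_fun_mult[OF XT smooth_atI[OF U p c] smooth_atI[OF U p L]]
        tangent_fun_const[OF XT] by simp
    finally have *: "X p (?T Y Z) = \<dots>" .
    have "X p f = 0" by (rule f0[OF XT])
    then have "cov_tensor2 D X ?L Y Z p = 0" using cov[OF X Y Z p] by simp
    then show ?thesis
      using * D_metric[OF X Y Z p] T[OF D_vector_field[OF X Y] Z p] T[OF Y D_vector_field[OF X Z] p]
      unfolding cov_tensor2_def by (simp add: algebra_simps)
  qed
  have "v lam = 0" if v: "v \<in> tangent_space A p" for v p
  proof -
    \<comment> \<open>The frame has to be the one that \<open>divergence\<close> uses at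
      \<open>p\<close>. The resulting sum is the frame expansion of \<open>X p\<close> applied to
      \<open>lam\<close>.\<close>
    let ?E = "local_frame A g p"
    obtain U1 X where U1: "p \<in> U1" "vector_field_on A U1 X" "X p = v"
      using tangent_extension[OF v] .
    obtain U2 where U2: "open U2" "p \<in> U2" "orthonormal_frame_on A g U2 ?E"
      by (rule local_frame_orthonormal)
    define U where "U = U1 \<inter> U2"
    have U: "open U" "p \<in> U" "U \<subseteq> U1" "U \<subseteq> U2"
      using U1 U2 vector_field_open by (auto simp: U_def)
    have X: "vector_field_on A U X" by (rule vector_field_restrict[OF U1(2) U(1,3)])
    have E: "orthonormal_frame_on A g U ?E" by (rule orthonormal_frame_restrict[OF U2(3) U(1,4)])
    note Ei = orthonormal_frame_vector_field[OF E]
    have "0 = divergence A g D ?T X p"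
      using assms(10) U1(1,2) unfolding divergence_free_def by simp
    also have "\<dots> = (\<Sum>i\<in>UNIV. ?E i p lam * ?m (?E i) X p)"
      by (simp add: divergence_def Let_def covT[OF Ei Ei X U(2)])
    also have "\<dots> = (\<Sum>i\<in>UNIV. g p (X p) (?E i p) * ?E i p lam)"
      using metric_app_sym[OF X Ei U(2)] by (simp add: metric_app_def mult.commute)
    also have "\<dots> = X p lam"
      using fun_cong[OF orthonormal_frame_expansion[OF E U(2) vector_field_tangent[OF X U(2)]], of lam]
      by simp
    finally show ?thesis using U1(3) by simp
  qed
  then have "\<exists>c. \<forall>p. lam p = c"
    using constant_if_tangent_derivative_zero[of lam] lam assms(2)
    unfolding riemannian_manifold_def by blast
  then show ?thesis
    using affine assms(5) unfolding omega_bach_soliton_def by blast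
qed

end
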